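(* Let $n\ge2$. The map $\overline C\mapsto\mathfrak g_{\overline C}$, for non-zero $\overline C\in\mathfrak o(n)$, induces a bijection from the set $\widetilde{\mathbb P^1(\mathfrak o(n))}$ of $\mathrm O(n)$-orbits in the projective space of $\mathfrak o(n)$ onto the set $\widehat{\mathscr S_{\mathrm s}}^{\mathrm i}(n+2)$ of i-isomorphism classes of solvable singular quadratic Lie algebra structures on $\mathbb C^{n+2}$.
   Context: All vector spaces are finite-dimensional over $\mathbb C$. $\mathbb C^n$ carries its canonical non-degenerate symmetric bilinear form $B$: for $n=2p$ with canonical basis $\{E_i,F_i\}_{1\le i\le p}$, $B(E_i,F_j)=\delta_{ij}$, $B(E_i,E_j)=B(F_i,F_j)=0$; for $n=2p+1$ with an additional basis vector $G$, orthogonal to all $E_i,F_i$, $B(G,G)=1$. $\mathrm O(n)$ is its isometry group and $\mathfrak o(n)$ the Lie algebra of $B$-skew-symmetric maps. $\mathrm O(n)$ acts on $\mathfrak o(n)$ by $U\cdot C=UCU^{-1}$, and on the projective space $\mathbb P^1(\mathfrak o(n))$ of lines of $\mathfrak o(n)$ by $U\cdot[C]=[UCU^{-1}]$. A quadratic Lie algebra $(\mathfrak g,B)$ is a Lie algebra with a non-degenerate symmetric invariant bilinear form ($B([X,Y],Z)=B(X,[Y,Z])$). An i-isomorphism is a Lie algebra isomorphism that is an isometry. Let $I(X,Y,Z)=B([X,Y],Z)$ and $\mathrm{dup}(\mathfrak g)=\dim\{\alpha\in\mathfrak g^*\mid\alpha\wedge I=0\}$; a non-Abelian quadratic Lie algebra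 is singular if $\mathrm{dup}(\mathfrak g)\ge1$. A quadratic Lie algebra structure on $\mathbb C^{n+2}$ is a Lie bracket for which the canonical form is invariant. For $\overline C\in\mathfrak o(n)$, $\mathfrak g_{\overline C}$ is the double extension of $\mathbb C^n$ by $\overline C$: the orthogonal direct sum $(\mathbb CX_1\oplus\mathbb CY_1)\oplus\mathbb C^n$, with $B(X_1,X_1)=B(Y_1,Y_1)=0$, $B(X_1,Y_1)=1$, with bracket $[X+\lambda X_1+\mu Y_1,\,Y+\lambda'X_1+\mu'Y_1]=\mu\overline C(Y)-\mu'\overline C(X)+B(\overline C(X),Y)X_1$ for $X,Y\in\mathbb C^n$; it is viewed as a structure on $\mathbb C^{n+2}$ via any isometry of this quadratic space with $\mathbb C^{n+2}$ (its i-isomorphism class does not depend on the isometry). *)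

theory Defs
  imports "HOL-Analysis.Analysis" "HOL-Library.Function_Algebras"
begin

section \<open>The canonical form on \<open>\<complex>\<^sup>n\<close>\<close>

text \<open>
  \<open>\<complex>\<^sup>n\<close> is \<open>'n cvec\<close> with \<open>CARD('n) = n\<close>; the linear order on the index type numbers the
  coordinates \<open>0, \<dots>, n - 1\<close>. With \<open>p = n div 2\<close>, the basis vectors \<open>E\<^sub>1, \<dots>, E\<^sub>p\<close> are the unit vectors
  at positions \<open>0, \<dots>, p - 1\<close>, the \<open>F\<^sub>1, \<dots>, F\<^sub>p\<close> those at positions \<open>p, \<dots>, 2p - 1\<close>, and, if \<open>n\<close> is odd,
  \<open>G\<close> is the one at position \<open>2p\<close>.
\<close>

type_synonym 'n cvec = "(complex, 'n) vec"

definition ix :: "nat \<Rightarrow> 'n::{finite,linorder}" where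
  "ix k = sorted_list_of_set UNIV ! k"

definition cform :: "'n::{finite,linorder} cvec \<Rightarrow> 'n cvec \<Rightarrow> complex" where
  "cform x y =
    (let p = CARD('n) div 2 in
      (\<Sum>i<p. x $ ix i * y $ ix (p + i) + x $ ix (p + i) * y $ ix i)
      + (if odd CARD('n) then x $ ix (2 * p) * y $ ix (2 * p) else 0))"

definition orthogonal_group :: "('n::{finite,linorder} cvec \<Rightarrow> 'n cvec) set" where
  "orthogonal_group =
    {U. Vector_Spaces.linear (*s) (*s) U \<and> bij U \<and> (\<forall>x y. cform (U x) (U y) = cform x y)}"

definition skew_maps :: "('n::{finite,linorder} cvec \<Rightarrow> 'n cvec) set" where
  "skew_maps =
    {C. Vector_Spaces.linear (*s) (*s) C \<and> (\<forall>x y. cform (C x) y = - cform x (C y))}"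


section \<open>Orbits in the projective space of \<open>\<oo>(n)\<close>\<close>

definition line :: "('n::finite cvec \<Rightarrow> 'n cvec) \<Rightarrow> ('n cvec \<Rightarrow> 'n cvec) set" where
  "line C = {\<lambda>x. c *s C x | c. True}"

definition proj_skew :: "('n::{finite,linorder} cvec \<Rightarrow> 'n cvec) set set" where
  "proj_skew = line ` (skew_maps - {0})"

definition conj_map ::
  "('n::finite cvec \<Rightarrow> 'n cvec) \<Rightarrow> ('n cvec \<Rightarrow> 'n cvec) \<Rightarrow> 'n cvec \<Rightarrow> 'n cvec" where
  "conj_map U C = U \<circ> C \<circ> inv U"

text \<open>The image of the line \<open>[C]\<close> under the linear map \<open>conj_map U\<close> is \<open>[U C U\<inverse>]\<close>.\<close>

definition orbit ::
  "('n::{finite,linorder} cvec \<Rightarrow> 'n cvec) set \<Rightarrow> ('n cvec \<Rightarrow> 'n cvec) set set" where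
  "orbit L = {conj_map U ` L | U. U \<in> orthogonal_group}"

definition proj_orbits :: "('n::{finite,linorder} cvec \<Rightarrow> 'n cvec) set set set" where
  "proj_orbits = orbit ` proj_skew"


section \<open>Quadratic Lie algebra structures\<close>

definition lie_bracket :: "('m::finite cvec \<Rightarrow> 'm cvec \<Rightarrow> 'm cvec) \<Rightarrow> bool" where
  "lie_bracket br \<longleftrightarrow>
    (\<forall>x. Vector_Spaces.linear (*s) (*s) (br x)) \<and>
    (\<forall>y. Vector_Spaces.linear (*s) (*s) (\<lambda>x. br x y)) \<and>
    (\<forall>x. br x x = 0) \<and>
    (\<forall>x y z. br x (br y z) + br y (br z x) + br z (br x y) = 0)"

definition quadratic_structure ::
  "('m::{finite,linorder} cvec \<Rightarrow> 'm cvec \<Rightarrow> 'm cvec) \<Rightarrow> bool" where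
  "quadratic_structure br \<longleftrightarrow>
    lie_bracket br \<and> (\<forall>x y z. cform (br x y) z = cform x (br y z))"

definition assoc_form ::
  "('m::{finite,linorder} cvec \<Rightarrow> 'm cvec \<Rightarrow> 'm cvec) \<Rightarrow>
    'm cvec \<Rightarrow> 'm cvec \<Rightarrow> 'm cvec \<Rightarrow> complex" where
  "assoc_form br x y z = cform (br x y) z"

text \<open>The exterior product of a 1-form and a 3-form, as a sum over \<open>(1,3)\<close>-shuffles.\<close>

definition wedge13 :: "('v \<Rightarrow> complex) \<Rightarrow> ('v \<Rightarrow> 'v \<Rightarrow> 'v \<Rightarrow> complex) \<Rightarrow> 'v \<Rightarrow> 'v \<Rightarrow> 'v \<Rightarrow> 'v \<Rightarrow> complex" where
  "wedge13 \<alpha> I x y z w =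
    \<alpha> x * I y z w - \<alpha> y * I x z w + \<alpha> z * I x y w - \<alpha> w * I x y z"

definition scale_form :: "complex \<Rightarrow> ('v \<Rightarrow> complex) \<Rightarrow> 'v \<Rightarrow> complex" where
  "scale_form c \<alpha> = (\<lambda>x. c * \<alpha> x)"

lemma vector_space_scale_form: "vector_space scale_form"
  by unfold_locales (auto simp: scale_form_def algebra_simps)

definition dup :: "('m::{finite,linorder} cvec \<Rightarrow> 'm cvec \<Rightarrow> 'm cvec) \<Rightarrow> nat" where
  "dup br = vector_space.dim scale_form
    {\<alpha>. Vector_Spaces.linear (*s) (*) \<alpha> \<and>
      (\<forall>x y z w. wedge13 \<alpha> (assoc_form br) x y z w = 0)}"

definition singular :: "('m::{finite,linorder} cvec \<Rightarrow> 'm cvec \<Rightarrow> 'm cvec) \<Rightarrow> bool" where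
  "singular br \<longleftrightarrow> \<not> (\<forall>x y. br x y = 0) \<and> dup br \<ge> 1"

primrec derived_series ::
  "('m::finite cvec \<Rightarrow> 'm cvec \<Rightarrow> 'm cvec) \<Rightarrow> nat \<Rightarrow> ('m cvec) set" where
  "derived_series br 0 = UNIV"
| "derived_series br (Suc k) =
    vec.span {br x y | x y. x \<in> derived_series br k \<and> y \<in> derived_series br k}"

definition solvable :: "('m::finite cvec \<Rightarrow> 'm cvec \<Rightarrow> 'm cvec) \<Rightarrow> bool" where
  "solvable br \<longleftrightarrow> (\<exists>k. derived_series br k = {0})"

definition solvable_singular_structures ::
  "('m::{finite,linorder} cvec \<Rightarrow> 'm cvec \<Rightarrow> 'm cvec) set" where
  "solvable_singular_structures = {br. quadratic_structure br \<and> singular br \<and> solvable br}"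

definition i_isomorphic ::
  "('m::{finite,linorder} cvec \<Rightarrow> 'm cvec \<Rightarrow> 'm cvec) \<Rightarrow>
    ('m cvec \<Rightarrow> 'm cvec \<Rightarrow> 'm cvec) \<Rightarrow> bool" where
  "i_isomorphic br br' \<longleftrightarrow> (\<exists>A \<in> orthogonal_group. \<forall>x y. A (br x y) = br' (A x) (A y))"

definition i_iso_rel ::
  "(('m::{finite,linorder} cvec \<Rightarrow> 'm cvec \<Rightarrow> 'm cvec) \<times>
    ('m cvec \<Rightarrow> 'm cvec \<Rightarrow> 'm cvec)) set" where
  "i_iso_rel =
    {(br, br'). br \<in> solvable_singular_structures \<and> br' \<in> solvable_singular_structures \<and>
      i_isomorphic br br'}"

definition i_iso_classes ::
  "('m::{finite,linorder} cvec \<Rightarrow> 'm cvec \<Rightarrow> 'm cvec) set set" where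
  "i_iso_classes = solvable_singular_structures // i_iso_rel"


section \<open>Double extensions\<close>

text \<open>The triple \<open>(l, m, X)\<close> stands for \<open>X + l X\<^sub>1 + m Y\<^sub>1\<close>.\<close>

type_synonym 'n dext_space = "complex \<times> complex \<times> 'n cvec"

definition dext_scale :: "complex \<Rightarrow> 'n::finite dext_space \<Rightarrow> 'n dext_space" where
  "dext_scale c = (\<lambda>(l, m, X). (c * l, c * m, c *s X))"

definition dext_form :: "'n::{finite,linorder} dext_space \<Rightarrow> 'n dext_space \<Rightarrow> complex" where
  "dext_form = (\<lambda>(l, m, X) (l', m', Y). l * m' + m * l' + cform X Y)"

definition dext_bracket ::
  "('n::{finite,linorder} cvec \<Rightarrow> 'n cvec) \<Rightarrow>
    'n dext_space \<Rightarrow> 'n dext_space \<Rightarrow> 'n dext_space" where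
  "dext_bracket C = (\<lambda>(l, m, X) (l', m', Y). (cform (C X) Y, 0, m *s C Y - m' *s C X))"

lemma vector_space_dext_scale: "vector_space dext_scale"
  by unfold_locales
    (auto simp: dext_scale_def algebra_simps vec.scale_right_distrib vec.scale_left_distrib)

definition dext_isometries ::
  "('n::{finite,linorder} dext_space \<Rightarrow> 'm::{finite,linorder} cvec) set" where
  "dext_isometries =
    {\<Phi>. Vector_Spaces.linear dext_scale (*s) \<Phi> \<and> bij \<Phi> \<and>
      (\<forall>u v. cform (\<Phi> u) (\<Phi> v) = dext_form u v)}"

definition dext_structure ::
  "('n::{finite,linorder} dext_space \<Rightarrow> 'm::{finite,linorder} cvec) \<Rightarrow>
    ('n cvec \<Rightarrow> 'n cvec) \<Rightarrow> 'm cvec \<Rightarrow> 'm cvec \<Rightarrow> 'm cvec" where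
  "dext_structure \<Phi> C x y = \<Phi> (dext_bracket C (inv \<Phi> x) (inv \<Phi> y))"


section \<open>Existence of the isometries\<close>

lemma bij_betw_ix: "bij_betw ix {..<CARD('n)} (UNIV :: 'n::{finite,linorder} set)"
proof -
  have "bij_betw ((!) (sorted_list_of_set (UNIV :: 'n set))) {..<CARD('n)} UNIV"
    by (rule bij_betw_nth) auto
  then show ?thesis
    by (simp add: ix_def[abs_def])
qed

lemma vec_eq_ixI:
  fixes x y :: "('a, 'n::{finite,linorder}) vec"
  assumes "\<And>k. k < CARD('n) \<Longrightarrow> x $ ix k = y $ ix k"
  shows "x = y"
proof -
  have "x $ i = y $ i" for i
  proof -
    have "i \<in> ix ` {..<CARD('n)}" using bij_betw_ix[where 'n='n] by (simp add: bij_betw_def)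
    then show ?thesis using assms by auto
  qed
  then show ?thesis by (simp add: vec_eq_iff)
qed

definition vec_of :: "(nat \<Rightarrow> 'a) \<Rightarrow> ('a, 'n::{finite,linorder}) vec" where
  "vec_of f = (\<chi> i. f (inv_into {..<CARD('n)} ix i))"

lemma vec_of_ix [simp]:
  assumes "k < CARD('n)"
  shows "(vec_of f :: ('a, 'n::{finite,linorder}) vec) $ ix k = f k"
proof -
  have "inj_on (ix :: nat \<Rightarrow> 'n) {..<CARD('n)} \<Longrightarrow> inv_into {..<CARD('n)} ix (ix k :: 'n) = k"
    using assms by (simp add: inv_into_f_f)
  then show ?thesis
    using bij_betw_ix[where 'n='n] by (simp add: vec_of_def bij_betw_def)
qed

lemma dext_isometries_nonempty:
  assumes card: "CARD('m::{finite,linorder}) = CARD('n::{finite,linorder}) + 2"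
  shows "(dext_isometries :: ('n dext_space \<Rightarrow> 'm cvec) set) \<noteq> {}"
proof -
  define p where "p = CARD('n) div 2"
  have n: "CARD('n) = (if odd CARD('n) then 2 * p + 1 else 2 * p)"
    unfolding p_def by presburger
  have pm: "CARD('m) div 2 = p + 1" using card unfolding p_def by simp
  have oddm: "odd CARD('m) \<longleftrightarrow> odd CARD('n)" using card by simp
  have le: "2 * p \<le> CARD('n)" unfolding p_def by simp
  define sh where "sh k = (if k < p then k else if k < 2 * p + 1 then k - 1 else k - 2)" for k
  define g :: "'n dext_space \<Rightarrow> nat \<Rightarrow> complex" where
    "g u k = (case u of (l, m, X) \<Rightarrow>
       if k = p then l else if k = 2 * p + 1 then m else X $ ix (sh k))" for u k
  define \<Phi> :: "'n dext_space \<Rightarrow> 'm cvec" where "\<Phi> u = vec_of (g u)" for u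
  have \<Phi>_ix: "\<Phi> u $ ix k = g u k" if "k < CARD('m)" for u k
    using that by (simp add: \<Phi>_def)
  interpret V1: vector_space "dext_scale :: complex \<Rightarrow> 'n dext_space \<Rightarrow> _"
    by (rule vector_space_dext_scale)
  have lin: "Vector_Spaces.linear dext_scale (*s) \<Phi>"
  proof
    show "\<Phi> (a + b) = \<Phi> a + \<Phi> b" for a b
      by (rule vec_eq_ixI) (auto simp: \<Phi>_ix g_def split: prod.splits)
    show "\<Phi> (dext_scale r b) = r *s \<Phi> b" for r b
      by (rule vec_eq_ixI) (auto simp: \<Phi>_ix g_def dext_scale_def split: prod.splits)
  qed
  have iso: "cform (\<Phi> u) (\<Phi> v) = dext_form u v" for u v
  proof -
    obtain l m X where u: "u = (l, m, X)" by (cases u)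
    obtain l' m' Y where v: "v = (l', m', Y)" by (cases v)
    have lt: "i < CARD('m)" "p + 1 + i < CARD('m)" if "i < p + 1" for i
      using that le card by auto
    have g1: "g u i = (if i < p then X $ ix i else l)" "g v i = (if i < p then Y $ ix i else l')"
      if "i < p + 1" for i using that by (auto simp: g_def u v sh_def)
    have g2: "g u (p + 1 + i) = (if i < p then X $ ix (p + i) else m)"
      "g v (p + 1 + i) = (if i < p then Y $ ix (p + i) else m')"
      if "i < p + 1" for i using that by (auto simp: g_def u v sh_def)
    have "(\<Sum>i<p+1. \<Phi> u $ ix i * \<Phi> v $ ix (p + 1 + i) + \<Phi> u $ ix (p + 1 + i) * \<Phi> v $ ix i)
        = (\<Sum>i<p+1. g u i * g v (p + 1 + i) + g u (p + 1 + i) * g v i)"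
      by (rule sum.cong) (simp_all only: \<Phi>_ix lt lessThan_iff)
    also have "\<dots> = (\<Sum>i<p+1. if i < p then X $ ix i * Y $ ix (p + i) + X $ ix (p + i) * Y $ ix i
        else l * m' + m * l')"
      by (rule sum.cong[OF refl]) (unfold lessThan_iff, subst g1, assumption, subst g1, assumption, subst g2, assumption, subst g2, assumption, simp)
    also have "\<dots> = (\<Sum>i<p. X $ ix i * Y $ ix (p + i) + X $ ix (p + i) * Y $ ix i) + (l * m' + m * l')"
      by simp
    finally have s: "(\<Sum>i<p+1. \<Phi> u $ ix i * \<Phi> v $ ix (p + 1 + i) + \<Phi> u $ ix (p + 1 + i) * \<Phi> v $ ix i) =
      (\<Sum>i<p. X $ ix i * Y $ ix (p + i) + X $ ix (p + i) * Y $ ix i) + (l * m' + m * l')" .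
    have o: "\<Phi> u $ ix (2 * (p + 1)) = X $ ix (2 * p)" "\<Phi> v $ ix (2 * (p + 1)) = Y $ ix (2 * p)"
      if "odd CARD('n)"
    proof -
      have "2 * (p + 1) < CARD('m)" using that n card by auto
      then show "\<Phi> u $ ix (2 * (p + 1)) = X $ ix (2 * p)" "\<Phi> v $ ix (2 * (p + 1)) = Y $ ix (2 * p)"
        by (simp_all add: \<Phi>_ix g_def u v sh_def)
    qed
    show ?thesis
      unfolding cform_def Let_def pm oddm s dext_form_def u[symmetric] v[symmetric]
      using o by (simp add: u v cform_def Let_def p_def[symmetric])
  qed
  have "inj \<Phi>"
  proof (rule injI)
    fix u v assume eq: "\<Phi> u = \<Phi> v"
    obtain l m X where u: "u = (l, m, X)" by (cases u)
    obtain l' m' Y where v: "v = (l', m', Y)" by (cases v)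
    have gg: "g u k = g v k" if "k < CARD('m)" for k
      using \<Phi>_ix[OF that] eq by metis
    have "X = Y"
    proof (rule vec_eq_ixI)
      fix k assume k: "k < CARD('n)"
      define k' where "k' = (if k < p then k else if k < 2 * p then k + 1 else k + 2)"
      have "k' < CARD('m)" "sh k' = k" "k' \<noteq> p" "k' \<noteq> 2 * p + 1"
        using k card by (auto simp: k'_def sh_def)
      then show "X $ ix k = Y $ ix k" using gg[of k'] by (simp add: g_def u v)
    qed
    moreover have "l = l'" using gg[of p] le card by (simp add: g_def u v)
    moreover have "m = m'" using gg[of "2 * p + 1"] le card by (simp add: g_def u v)
    ultimately show "u = v" by (simp add: u v)
  qed
  moreover have "surj \<Phi>"
  proof (rule surjI)
    fix x :: "'m cvec"
    define X :: "'n cvec" where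
      "X = vec_of (\<lambda>k. x $ ix (if k < p then k else if k < 2 * p then k + 1 else k + 2))"
    show "\<Phi> (x $ ix p, x $ ix (2 * p + 1),
        vec_of (\<lambda>k. x $ ix (if k < p then k else if k < 2 * p then k + 1 else k + 2))) = x"
      unfolding X_def[symmetric]
    proof (rule vec_eq_ixI)
      fix k assume k: "k < CARD('m)"
      consider "k = p" | "k = 2 * p + 1" | "k < p" | "p < k" "k < 2 * p + 1" | "2 * p + 1 < k"
        by linarith
      then show "\<Phi> (x $ ix p, x $ ix (2 * p + 1), X) $ ix k = x $ ix k"
      proof cases
        case 3
        then have "k < CARD('n)" using le by simp
        then show ?thesis using 3 k by (simp add: \<Phi>_ix g_def sh_def X_def)
      next
        case 4
        then obtain j where j: "k = Suc j" by (cases k) auto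
        have "j < CARD('n)" "\<not> j < p" "j < 2 * p" using 4 le j by auto
        then show ?thesis using 4 k j by (simp add: \<Phi>_ix g_def sh_def X_def)
      next
        case 5
        then have "k = (k - 2) + 2" by simp
        then obtain j where j: "k = j + 2" by blast
        have "j < CARD('n)" "\<not> j < p" "\<not> j < 2 * p" using 5 le j k card by auto
        then show ?thesis using 5 k j by (simp add: \<Phi>_ix g_def sh_def X_def)
      qed (use k in \<open>simp_all add: \<Phi>_ix g_def\<close>)
    qed
  qed
  ultimately have "\<Phi> \<in> dext_isometries"
    using lin iso by (simp add: dext_isometries_def bij_def)
  then show ?thesis by blast
qed

end

theory Submission
  imports Defs
begin

text \<open>
  Write \<open>B\<close> for the canonical form, \<open>v\<^sup>\<flat> = B(v, \<cdot>)\<close> and \<open>I(x, y, z) = B([x, y], z)\<close>. Since every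
  1-form is some \<open>v\<^sup>\<flat>\<close>, a non-Abelian structure is singular if some \<open>v \<noteq> 0\<close> satisfies \<open>v\<^sup>\<flat> \<and> I = 0\<close>; call such a
  vector a divisor of \<open>I\<close>. In the double extension by \<open>C\<close>, the 3-form is
  \<open>I = X\<^sub>1\<^sup>\<flat> \<and> B(C \<cdot>, \<cdot>)\<close> and \<open>X\<^sub>1\<close> is a central divisor. The proof consists in reversing this.

  \<^bold>\<open>From a central divisor to a double extension.\<close> A divisor \<open>v\<close> of a non-Abelian structure is
  orthogonal to the center, so a central divisor is isotropic. By transitivity of the orthogonal
  group on non-zero isotropic vectors, the quadratic space splits as the double extension does, with
  \<open>v\<close> in the place of \<open>X\<^sub>1\<close>. If \<open>u\<close> has the place of \<open>Y\<^sub>1\<close>, then \<open>v\<^sup>\<flat> \<and> I = 0\<close> and \<open>v\<^sup>\<flat>(u) = 1\<close> express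
  the whole bracket by \<open>ad u\<close>, and \<open>ad u\<close> preserves \<open>\<complex>\<^sup>n\<close> because \<open>v\<close> is central. Its restriction is
  \<open>C\<close> (\<open>central_divisor_dext_structure\<close>).

  \<^bold>\<open>Surjectivity.\<close> It remains to find a central divisor in a solvable singular structure
  (\<open>solvable_singular_central_divisor\<close>). Together with \<open>0\<close>, the divisors form an ideal. A divisor \<open>a\<close> spanning an ideal
  is central, by invariance of \<open>B\<close>. Otherwise there is a second, linearly independent divisor \<open>b\<close>,
  and \<open>I\<close> is decomposable, a product \<open>a\<^sup>\<flat> \<and> b\<^sup>\<flat> \<and> c\<^sup>\<flat>\<close>. If \<open>B\<close> were non-degenerate on
  \<open>W = \<langle>a, b, c\<rangle>\<close>, then \<open>W\<close> would be its own derived algebra, against solvability; and a non-zero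
  vector of \<open>W\<close> orthogonal to \<open>W\<close> is a central divisor, since its contraction with \<open>I\<close> vanishes.

  \<^bold>\<open>Injectivity.\<close> An i-isomorphism of double extensions need not preserve the line of \<open>X\<^sub>1\<close>, since
  there can be independent central divisors. However, if \<open>v\<close> and \<open>w\<close> are two of them, there is an
  isometric automorphism that maps \<open>v\<close> into the line of \<open>w\<close> (\<open>central_divisors_conjugate\<close>): the
  Siegel map of an isotropic plane spanned by \<open>w - v\<close> and some \<open>u\<close> maps \<open>v\<close> to \<open>w\<close>, and it preserves
  \<open>I\<close> because \<open>w - v\<close> is again a central vector with \<open>(w - v)\<^sup>\<flat> \<and> I = 0\<close>. Composing with this
  automorphism, the i-isomorphism maps \<open>X\<^sub>1\<close> to \<open>k X\<^sub>1\<close>. It then induces on \<open>X\<^sub>1\<^sup>\<bottom> / \<langle>X\<^sub>1\<rangle> = \<complex>\<^sup>n\<close> an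
  isometry \<open>U\<close> with \<open>C' U = k U C\<close> (\<open>dext_structure_eq_imp_conjugate\<close>). Conversely, such \<open>U\<close> and \<open>k\<close>
  give the i-isomorphism \<open>X + l X\<^sub>1 + m Y\<^sub>1 \<mapsto> U X + k l X\<^sub>1 + (m / k) Y\<^sub>1\<close>.
\<close>

section \<open>Linear maps between coordinate spaces\<close>

lemma linear_cvec_iff:
  "Vector_Spaces.linear (*s) (*s) f \<longleftrightarrow>
    (\<forall>x y. f (x + y) = f x + f y) \<and> (\<forall>c x. f (c *s x) = c *s f x)"
  for f :: "('a::field) ^ 'n \<Rightarrow> 'a ^ 'm"
  by (simp add: Vector_Spaces.linear_iff vec.vector_space_axioms)

lemma linear_functional_iff:
  "Vector_Spaces.linear (*s) (*) f \<longleftrightarrow>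
    (\<forall>x y. f (x + y) = f x + f y) \<and> (\<forall>c x. f (c *s x) = c * f x)"
  for f :: "'n::finite cvec \<Rightarrow> complex"
proof -
  have "vector_space ((*) :: complex \<Rightarrow> _)" by unfold_locales (auto simp: algebra_simps)
  then show ?thesis by (simp add: Vector_Spaces.linear_iff vec.vector_space_axioms)
qed

lemma linear_dext_iff:
  "Vector_Spaces.linear dext_scale (*s) f \<longleftrightarrow>
    (\<forall>x y. f (x + y) = f x + f y) \<and> (\<forall>c x. f (dext_scale c x) = c *s f x)"
  for f :: "'n::finite dext_space \<Rightarrow> 'm::finite cvec"
  by (simp add: Vector_Spaces.linear_iff vec.vector_space_axioms vector_space_dext_scale del: split_paired_All)

section \<open>The canonical form\<close>

lemma cform_commute: "cform x y = cform y x"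
  unfolding cform_def Let_def by (auto simp: mult.commute add.commute intro!: sum.cong)

lemma cform_add_left: "cform (x + y) z = cform x z + cform y z"
  unfolding cform_def Let_def by (auto simp: algebra_simps sum.distrib)

lemma cform_scale_left: "cform (c *s x) z = c * cform x z"
  unfolding cform_def Let_def by (auto simp: algebra_simps sum_distrib_left)

lemma cform_add_right: "cform z (x + y) = cform z x + cform z y"
  by (metis cform_add_left cform_commute)

lemma cform_scale_right: "cform z (c *s x) = c * cform z x"
  by (metis cform_scale_left cform_commute)

lemma cform_minus_left: "cform (- x) z = - cform x z"
  using cform_scale_left[of "-1" x z] by simp

lemma cform_minus_right: "cform z (- x) = - cform z x"
  by (metis cform_minus_left cform_commute)

lemma cform_diff_left: "cform (x - y) z = cform x z - cform y z"
  using cform_add_left[of x "- y" z] by (simp add: cform_minus_left)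

lemma cform_diff_right: "cform z (x - y) = cform z x - cform z y"
  by (metis cform_diff_left cform_commute)

lemma cform_zero_left [simp]: "cform 0 z = 0"
  using cform_scale_left[of 0 0 z] by simp

lemma cform_zero_right [simp]: "cform z 0 = 0"
  by (metis cform_zero_left cform_commute)

lemmas cform_simps = cform_add_left cform_add_right cform_scale_left cform_scale_right
  cform_minus_left cform_minus_right cform_diff_left cform_diff_right

lemma ix_eq_iff:
  assumes "i < CARD('n)" "j < CARD('n)"
  shows "(ix i :: 'n::{finite,linorder}) = ix j \<longleftrightarrow> i = j"
  using bij_betw_ix[where 'n='n] assms by (auto simp: bij_betw_def inj_on_def)

text \<open>Each coordinate of \<open>x\<close> is the value of the form at \<open>x\<close> and some unit vector.\<close>

lemma cform_nondegenerate:
  fixes x :: "'n::{finite,linorder} cvec"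
  assumes "\<And>y. cform x y = 0"
  shows "x = 0"
proof (rule vec_eq_ixI)
  fix k assume k: "k < CARD('n)"
  define p where "p = CARD('n) div 2"
  have p: "2 * p \<le> CARD('n)" by (simp add: p_def)
  have ax: "axis (ix j) (1::complex) $ (ix i :: 'n) = (if i = j then 1 else 0)"
    if "i < CARD('n)" "j < CARD('n)" for i j
    using that by (simp add: axis_def ix_eq_iff)
  have odd_iff: "odd CARD('n) \<longleftrightarrow> CARD('n) = 2 * p + 1"
    unfolding p_def by presburger
  have form: "cform x (axis (ix j) 1) = 
      (\<Sum>i<p. (if p + i = j then x $ ix i else 0) + (if i = j then x $ ix (p + i) else 0))
      + (if odd CARD('n) \<and> 2 * p = j then x $ ix (2 * p) else 0)" if j: "j < CARD('n)" for j
  proof -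
    have "(\<Sum>i<p. x $ ix i * (axis (ix j) 1 :: 'n cvec) $ ix (p + i) + x $ ix (p + i) * (axis (ix j) 1 :: 'n cvec) $ ix i) =
        (\<Sum>i<p. (if p + i = j then x $ ix i else 0) + (if i = j then x $ ix (p + i) else 0))"
    proof (intro sum.cong refl)
      fix i assume "i \<in> {..<p}"
      then have "i < CARD('n)" "p + i < CARD('n)" using p by auto
      then show "x $ ix i * (axis (ix j) 1 :: 'n cvec) $ ix (p + i) + x $ ix (p + i) * (axis (ix j) 1 :: 'n cvec) $ ix i =
          (if p + i = j then x $ ix i else 0) + (if i = j then x $ ix (p + i) else 0)"
        by (simp add: ax[OF _ j])
    qed
    moreover have "odd CARD('n) \<Longrightarrow> axis (ix j) (1::complex) $ (ix (2 * p) :: 'n) = (if 2 * p = j then 1 else 0)"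
      using j odd_iff by (intro ax) auto
    ultimately show ?thesis unfolding cform_def Let_def p_def[symmetric] by simp
  qed
  consider "k < p" | "p \<le> k" "k < 2 * p" | "odd CARD('n)" "k = 2 * p"
    using k p odd_iff unfolding p_def by fastforce
  then have "x $ ix k = 0"
  proof cases
    case 1
    have "cform x (axis (ix (p + k)) 1) = (\<Sum>i<p. if i = k then x $ ix i else 0)"
      using 1 p by (subst form) (auto intro!: sum.cong)
    then show ?thesis using 1 assms by simp
  next
    case 2
    have "cform x (axis (ix (k - p)) 1) = (\<Sum>i<p. if i = k - p then x $ ix (p + i) else 0)"
      using 2 p by (subst form) (auto intro!: sum.cong)
    moreover have "k - p < p" "p + (k - p) = k" using 2 by auto
    ultimately show ?thesis using assms by simp
  next
    case 3
    have "cform x (axis (ix k) 1) = x $ ix k"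
      using 3 k by (subst form) (auto intro!: sum.neutral)
    then show ?thesis using assms by simp
  qed
  then show "x $ ix k = 0 $ ix k" by simp
qed

lemma cform_eqI:
  assumes "\<And>z. cform x z = cform y z"
  shows "x = y"
  using cform_nondegenerate[of "x - y"] assms by (simp add: cform_simps)

text \<open>
  By non-degeneracy, sending \<open>a\<close> to the values of \<open>a\<^sup>\<flat>\<close> on the unit vectors is an injective endomorphism
  of \<open>\<complex>\<^sup>n\<close>, hence it attains the values of any functional.
\<close>

lemma functional_representation:
  fixes \<alpha> :: "'n::{finite,linorder} cvec \<Rightarrow> complex"
  assumes "Vector_Spaces.linear (*s) (*) \<alpha>"
  obtains a where "\<alpha> = cform a"
proof -
  define f :: "'n cvec \<Rightarrow> 'n cvec" where "f x = (\<chi> i. cform x (axis i 1))" for x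
  have expand: "y = (\<Sum>i\<in>UNIV. y $ i *s axis i 1)" for y :: "'n cvec"
    by (rule basis_expansion[symmetric])
  have eq: "g = h" if "Vector_Spaces.linear (*s) (*) g" "Vector_Spaces.linear (*s) (*) h"
    "\<And>i. g (axis i 1) = h (axis i 1)" for g h :: "'n cvec \<Rightarrow> complex"
  proof
    fix y :: "'n cvec"
    have "g' y = (\<Sum>i\<in>UNIV. y $ i * g' (axis i 1))"
      if "Vector_Spaces.linear (*s) (*) g'" for g' :: "'n cvec \<Rightarrow> complex"
    proof -
      interpret g': Vector_Spaces.linear "(*s)" "(*)" g' by (rule that)
      show ?thesis by (subst expand) (simp only: g'.sum g'.scale)
    qed
    from this[OF that(1)] this[OF that(2)] show "g y = h y" by (simp add: that(3))
  qed
  have lin: "Vector_Spaces.linear (*s) (*) (cform x)" for x :: "'n cvec"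
    by (simp add: linear_functional_iff cform_simps)
  have flin: "Vector_Spaces.linear (*s) (*s) f"
    by (simp add: linear_cvec_iff f_def vec_eq_iff cform_simps)
  have "inj f"
  proof (rule injI)
    fix x y assume "f x = f y"
    then have "cform x = cform y" by (intro eq lin) (simp add: f_def vec_eq_iff)
    then show "x = y" by (intro cform_eqI) simp
  qed
  then have "surj f" using vec.linear_inj_imp_surj flin by blast
  then obtain a where "f a = (\<chi> i. \<alpha> (axis i 1))" by (metis surjD)
  then have "\<alpha> = cform a" by (intro eq lin assms) (simp add: f_def vec_eq_iff)
  then show ?thesis by (rule that)
qed

lemma cform_dual_vector:
  assumes "a \<noteq> 0"
  obtains u where "cform a u = 1"
proof -
  obtain y where "cform a y \<noteq> 0" using assms cform_nondegenerate by blast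
  then have "cform a ((1 / cform a y) *s y) = 1" by (simp add: cform_simps)
  then show ?thesis by (rule that)
qed

text \<open>
  If every vector orthogonal to \<open>a\<close> were orthogonal to \<open>b\<close>, then \<open>b\<close> would be a multiple of \<open>a\<close>. So some
  \<open>w\<close> adjusts the pairing with \<open>b\<close> without changing the pairing with \<open>a\<close>.
\<close>

lemma cform_dual_pair:
  assumes "a \<noteq> 0" and indep: "\<And>c. b \<noteq> c *s a"
  obtains u where "cform a u = s" "cform b u = t"
proof -
  obtain r where r: "cform a r = 1" using cform_dual_vector[OF \<open>a \<noteq> 0\<close>] .
  have "\<exists>w. cform a w = 0 \<and> cform b w \<noteq> 0"
  proof (rule ccontr)
    assume *: "\<not> ?thesis"
    have "b = cform b r *s a"
    proof (rule cform_eqI)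
      fix y
      have "cform a (y - cform a y *s r) = 0" by (simp add: cform_simps r)
      then have "cform b (y - cform a y *s r) = 0" using * by blast
      then show "cform b y = cform (cform b r *s a) y" by (simp add: cform_simps)
    qed
    then show False using indep by blast
  qed
  then obtain w where w: "cform a w = 0" "cform b w \<noteq> 0" by blast
  have "cform a (s *s r + ((t - s * cform b r) / cform b w) *s w) = s"
    "cform b (s *s r + ((t - s * cform b r) / cform b w) *s w) = t"
    using w by (simp_all add: cform_simps r)
  then show ?thesis by (rule that)
qed

text \<open>
  The form is non-degenerate, so linear maps that preserve it are injective; in finite dimension they
  are then bijective.
\<close>

lemma orthogonal_groupI:
  assumes lin: "Vector_Spaces.linear (*s) (*s) U" and iso: "\<And>x y. cform (U x) (U y) = cform x y"
  shows "U \<in> orthogonal_group"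
proof -
  have "inj U"
  proof (rule injI)
    fix x y assume "U x = U y"
    then have "cform x z = cform y z" for z using iso by metis
    then show "x = y" by (rule cform_eqI)
  qed
  moreover from this have "surj U" using vec.linear_inj_imp_surj lin by blast
  ultimately show ?thesis using assms by (simp add: orthogonal_group_def bij_def)
qed

lemma orthogonal_group_linear:
  assumes "U \<in> orthogonal_group"
  shows "U (x + y) = U x + U y" "U (c *s x) = c *s U x" "U (x - y) = U x - U y" "U 0 = 0"
proof -
  interpret U: Vector_Spaces.linear "(*s)" "(*s)" U
    using assms by (simp add: orthogonal_group_def)
  show "U (x + y) = U x + U y" "U (c *s x) = c *s U x" "U (x - y) = U x - U y" "U 0 = 0"
    by (simp_all add: U.add U.scale U.diff U.zero)
qed

lemma orthogonal_group_isometry: "U \<in> orthogonal_group \<Longrightarrow> cform (U x) (U y) = cform x y"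
  by (simp add: orthogonal_group_def)

lemma orthogonal_group_bij: "U \<in> orthogonal_group \<Longrightarrow> bij U"
  by (simp add: orthogonal_group_def)

lemma orthogonal_group_inv_simps:
  assumes "U \<in> orthogonal_group"
  shows "inv U (U x) = x" "U (inv U x) = x"
  using orthogonal_group_bij[OF assms] by (simp_all add: bij_is_inj bij_is_surj surj_f_inv_f)

lemma orthogonal_group_id: "(\<lambda>x. x) \<in> orthogonal_group"
  by (rule orthogonal_groupI) (simp_all add: linear_cvec_iff)

lemma orthogonal_group_comp:
  assumes "U \<in> orthogonal_group" "V \<in> orthogonal_group"
  shows "(\<lambda>x. U (V x)) \<in> orthogonal_group"
  using assms by (intro orthogonal_groupI)
    (simp_all add: linear_cvec_iff orthogonal_group_linear orthogonal_group_isometry)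

lemma orthogonal_group_inv:
  assumes U: "U \<in> orthogonal_group"
  shows "inv U \<in> orthogonal_group"
proof (rule orthogonal_groupI)
  have inj: "U x = U y \<Longrightarrow> x = y" for x y
    using orthogonal_group_bij[OF U] by (simp add: bij_is_inj inj_eq)
  show "Vector_Spaces.linear (*s) (*s) (inv U)"
    unfolding linear_cvec_iff
    by (intro conjI allI; rule inj)
      (simp_all add: orthogonal_group_linear[OF U] orthogonal_group_inv_simps[OF U])
  show "cform (inv U x) (inv U y) = cform x y" for x y
    using orthogonal_group_isometry[OF U, of "inv U x" "inv U y"]
    by (simp add: orthogonal_group_inv_simps[OF U])
qed

section \<open>Isometries moving isotropic vectors\<close>

text \<open>
  The Siegel (or Eichler) transformation. The map \<open>x \<mapsto> B(u, x) q - B(q, x) u\<close> is skew, and for an isotropic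
  plane \<open>\<langle>u, q\<rangle>\<close> its square is zero, so that \<open>siegel_map u q\<close> is its exponential.
\<close>

definition siegel_map :: "'n::{finite,linorder} cvec \<Rightarrow> 'n cvec \<Rightarrow> 'n cvec \<Rightarrow> 'n cvec" where
  "siegel_map u q x = x + cform u x *s q - cform q x *s u"

lemma siegel_map_orthogonal:
  assumes "cform u u = 0" "cform q q = 0" "cform u q = 0"
  shows "siegel_map u q \<in> orthogonal_group"
proof (rule orthogonal_groupI)
  show "Vector_Spaces.linear (*s) (*s) (siegel_map u q)"
    by (simp add: linear_cvec_iff siegel_map_def cform_simps vec.scale_left_distrib
        vec.scale_right_distrib vec.scale_right_diff_distrib algebra_simps)
  show "cform (siegel_map u q x) (siegel_map u q y) = cform x y" for x y
    using assms cform_commute[of q u] cform_commute[of x u] cform_commute[of x q]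
    by (simp add: siegel_map_def cform_simps algebra_simps)
qed

text \<open>
  The condition on \<open>u\<close> is \<open>B(u, a) = B(u, b) = 1\<close>; then the summand \<open>B(u, a) (b - a)\<close> moves \<open>a\<close> to \<open>b\<close>,
  and \<open>u\<close> is orthogonal to \<open>b - a\<close>.
\<close>

lemma siegel_direction_exists:
  assumes a: "a \<noteq> 0" and indep: "\<And>c. b \<noteq> c *s a"
    and iso: "cform a a = 0" "cform b b = 0" "cform a b = 0"
  obtains u where "cform u u = 0" "cform (b - a) (b - a) = 0" "cform u (b - a) = 0"
    "siegel_map u (b - a) a = b"
proof -
  obtain v where v: "cform a v = 1" "cform b v = 1"
    using cform_dual_pair[OF a indep] .
  \<comment> \<open>The multiple of \<open>a\<close> makes \<open>u\<close> isotropic and keeps its pairings with \<open>a\<close> and \<open>b\<close>.\<close>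
  define u where "u = v - (cform v v / 2) *s a"
  have comm: "cform v a = 1" "cform v b = 1" "cform b a = 0"
    using v iso cform_commute by metis+
  have u: "cform u u = 0" "cform u a = 1" "cform u b = 1"
    by (simp_all add: u_def cform_simps v comm iso)
  have "cform (b - a) (b - a) = 0" "cform u (b - a) = 0" "siegel_map u (b - a) a = b"
    by (simp_all add: siegel_map_def cform_simps u iso comm)
  with u(1) show ?thesis by (rule that)
qed

text \<open>
  Here \<open>b - a\<close> is anisotropic, and the reflection in its orthogonal complement exchanges \<open>a\<close> and \<open>b\<close>.
\<close>

lemma reflection_moves_isotropic:
  assumes iso: "cform a a = 0" "cform b b = 0" and ab: "cform a b \<noteq> 0"
  obtains T where "T \<in> orthogonal_group" "T a = b"
proof -
  define T where "T x = x + (cform (b - a) x / cform a b) *s (b - a)" for x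
  have ba: "cform b a = cform a b" by (rule cform_commute)
  have q: "cform (b - a) (b - a) = - 2 * cform a b"
    by (simp add: cform_simps iso ba)
  have "T \<in> orthogonal_group"
  proof (rule orthogonal_groupI)
    show "Vector_Spaces.linear (*s) (*s) T"
      by (simp add: linear_cvec_iff T_def cform_add_right cform_scale_right vec.scale_left_distrib
        vec.scale_right_distrib add_divide_distrib)
    show "cform (T x) (T y) = cform x y" for x y
      unfolding T_def cform_add_left cform_add_right cform_scale_left cform_scale_right q
        cform_commute[of x "b - a"] using ab by (simp add: field_simps)
  qed
  moreover have "T a = b" using ab by (simp add: T_def cform_simps iso ba)
  ultimately show ?thesis by (rule that)
qed

section \<open>Quadratic structures and divisors of their 3-form\<close>

lemma quadratic_structure_simps:
  assumes "quadratic_structure br"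
  shows "br x (y + z) = br x y + br x z" "br (x + y) z = br x z + br y z"
    "br x (c *s y) = c *s br x y" "br (c *s x) y = c *s br x y"
    "br x (y - z) = br x y - br x z" "br (x - y) z = br x z - br y z"
    "br x 0 = 0" "br 0 x = 0" "br x x = 0"
proof -
  have lb: "lie_bracket br" using assms by (simp add: quadratic_structure_def)
  interpret r: Vector_Spaces.linear "(*s)" "(*s)" "br x" for x
    using lb by (simp add: lie_bracket_def)
  interpret l: Vector_Spaces.linear "(*s)" "(*s)" "\<lambda>x. br x y" for y
    using lb by (simp add: lie_bracket_def)
  show "br x (y + z) = br x y + br x z" "br (x + y) z = br x z + br y z"
    "br x (c *s y) = c *s br x y" "br (c *s x) y = c *s br x y"
    "br x (y - z) = br x y - br x z" "br (x - y) z = br x z - br y z"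
    "br x 0 = 0" "br 0 x = 0"
    by (simp_all add: r.add l.add r.scale l.scale r.diff l.diff r.zero l.zero)
  show "br x x = 0" using lb by (simp add: lie_bracket_def)
qed

lemma quadratic_structure_antisym:
  assumes q: "quadratic_structure br"
  shows "br y x = - br x y"
proof -
  have "br y x + br x y = (br x x + br y x) + (br x y + br y y)"
    by (simp add: quadratic_structure_simps(9)[OF q])
  also have "\<dots> = br (x + y) (x + y)"
    by (simp only: quadratic_structure_simps(1-2)[OF q])
  also have "\<dots> = 0" by (rule quadratic_structure_simps(9)[OF q])
  finally show ?thesis by (simp only: eq_neg_iff_add_eq_0)
qed

lemma quadratic_structure_invariant:
  assumes "quadratic_structure br"
  shows "cform (br x y) z = cform x (br y z)"
  using assms by (simp add: quadratic_structure_def)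

lemma quadratic_structure_jacobi:
  assumes "quadratic_structure br"
  shows "br x (br y z) + br y (br z x) + br z (br x y) = 0"
  using assms by (simp add: quadratic_structure_def lie_bracket_def)

lemma assoc_form_alternating:
  assumes q: "quadratic_structure br"
  shows "cform (br y x) z = - cform (br x y) z" "cform (br x z) y = - cform (br x y) z"
    "cform (br z x) y = cform (br x y) z"
proof -
  show 1: "cform (br y x) z = - cform (br x y) z" for x y z
    using quadratic_structure_antisym[OF q, of y x] by (simp add: cform_simps)
  show 2: "cform (br z x) y = cform (br x y) z" for x y z
    using quadratic_structure_invariant[OF q, of z x y] cform_commute by metis
  show "cform (br x z) y = - cform (br x y) z"
    using 1[of x z y] 2[of z x y] by simp
qed

text \<open>
  Over a field, \<open>v\<^sup>\<flat> \<and> I = 0\<close> with \<open>v \<noteq> 0\<close> means that \<open>v\<^sup>\<flat>\<close> is a factor of \<open>I\<close> in the exterior algebra.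
\<close>

definition divides_assoc_form ::
  "('m::{finite,linorder} cvec \<Rightarrow> 'm cvec \<Rightarrow> 'm cvec) \<Rightarrow> 'm cvec \<Rightarrow> bool" where
  "divides_assoc_form br v \<longleftrightarrow>
    (\<forall>x y z w. wedge13 (cform v) (assoc_form br) x y z w = 0)"

text \<open>
  The abstract form of the vector \<open>X\<^sub>1\<close> of a double extension.
\<close>

definition central_divisor ::
  "('m::{finite,linorder} cvec \<Rightarrow> 'm cvec \<Rightarrow> 'm cvec) \<Rightarrow> 'm cvec \<Rightarrow> bool" where
  "central_divisor br v \<longleftrightarrow> v \<noteq> 0 \<and> (\<forall>x. br v x = 0) \<and> divides_assoc_form br v"

lemma divisor_cform:
  assumes "divides_assoc_form br v"
  shows "cform v x * cform (br y z) w - cform v y * cform (br x z) w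
    + cform v z * cform (br x y) w - cform v w * cform (br x y) z = 0"
  using assms by (simp add: divides_assoc_form_def wedge13_def assoc_form_def)

text \<open>
  Contracting \<open>v\<^sup>\<flat> \<and> I = 0\<close> with a central \<open>z\<close> leaves \<open>B(v, z) I = 0\<close>.
\<close>

lemma divisor_orthogonal_center:
  assumes "divides_assoc_form br v" and z: "\<And>x. br z x = 0" and "br x y \<noteq> 0"
  shows "cform v z = 0"
proof -
  obtain w where w: "cform (br x y) w \<noteq> 0" using cform_nondegenerate \<open>br x y \<noteq> 0\<close> by blast
  have "cform v z * cform (br x y) w = 0"
    using divisor_cform[OF assms(1), of z x y w] by (simp add: z)
  with w show ?thesis by simp
qed

lemma divisor_diff:
  assumes "divides_assoc_form br v" "divides_assoc_form br w"
  shows "divides_assoc_form br (v - w)"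
proof -
  have "wedge13 (cform (v - w)) f x y z u = wedge13 (cform v) f x y z u - wedge13 (cform w) f x y z u"
    for f x y z u
    by (simp add: wedge13_def cform_simps algebra_simps)
  with assms show ?thesis by (simp add: divides_assoc_form_def)
qed

text \<open>
  Modulo the center, \<open>siegel_map u p\<close> is the identity minus \<open>p\<^sup>\<flat> \<otimes> u\<close>, so the change it makes in
  \<open>I\<close> is the contraction with \<open>u\<close> of \<open>p\<^sup>\<flat> \<and> I\<close>, up to sign.
\<close>

lemma siegel_map_automorphism:
  assumes q: "quadratic_structure br"
    and c: "\<And>x. br p x = 0" and d: "divides_assoc_form br p"
    and u: "cform u u = 0" "cform p p = 0" "cform u p = 0"
  shows "siegel_map u p (br x y) = br (siegel_map u p x) (siegel_map u p y)"
proof (rule cform_eqI)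
  fix z
  note O = siegel_map_orthogonal[OF u]
  define z' where "z' = inv (siegel_map u p) z"
  have z: "z = siegel_map u p z'"
    using orthogonal_group_inv_simps[OF O] by (simp add: z'_def)
  have c': "br x p = 0" for x using quadratic_structure_antisym[OF q, of x p] c[of x] by simp
  have p: "cform (br x y) p = 0" for x y
    by (simp add: quadratic_structure_invariant[OF q] c')
  have uu: "cform (br x u) u = 0" "cform (br u x) u = 0" for x
    using quadratic_structure_invariant[OF q, of x u u] assoc_form_alternating(1)[OF q, of u x u]
    by (simp_all add: quadratic_structure_simps[OF q])
  have pu: "cform p u = 0" using u cform_commute by metis
  have "cform (br (siegel_map u p x) (siegel_map u p y)) z = cform (br x y) z'
      - (cform p x * cform (br u y) z' - cform p y * cform (br u x) z' + cform p z' * cform (br x y) u)"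
    unfolding z siegel_map_def
    by (simp add: quadratic_structure_simps[OF q] cform_simps c c' p uu
        assoc_form_alternating(1)[OF q, of x u z'] algebra_simps)
  also have "\<dots> = cform (br x y) z'"
    using divisor_cform[OF d, of u x y z'] assoc_form_alternating(3)[OF q, of u x y]
    unfolding pu by algebra
  also have "\<dots> = cform (siegel_map u p (br x y)) z"
    unfolding z by (rule orthogonal_group_isometry[OF O, symmetric])
  finally show "cform (siegel_map u p (br x y)) z
      = cform (br (siegel_map u p x) (siegel_map u p y)) z" ..
qed

text \<open>
  Central divisors are pairwise orthogonal and isotropic, so two independent ones are joined by a Siegel
  map, along a difference that is central and divides \<open>I\<close>. The scalar only serves the proportional case.
\<close>

lemma central_divisors_conjugate:
  assumes q: "quadratic_structure br" and nonab: "br x y \<noteq> 0"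
    and v: "central_divisor br v" and w: "central_divisor br w"
  obtains T c where "T \<in> orthogonal_group" "\<And>x y. T (br x y) = br (T x) (T y)"
    "c \<noteq> 0" "T v = c *s w"
proof (cases "\<exists>c. w = c *s v")
  case True
  then obtain c where c: "w = c *s v" by blast
  with w have "c \<noteq> 0" by (auto simp: central_divisor_def)
  with c have "v = inverse c *s w" by simp
  with \<open>c \<noteq> 0\<close> show ?thesis
    using that[of "\<lambda>x. x" "inverse c"] orthogonal_group_id by auto
next
  case False
  have d: "divides_assoc_form br v" "divides_assoc_form br w"
    and c: "br v x = 0" "br w x = 0" for x
    using v w by (simp_all add: central_divisor_def)
  have orth: "cform v v = 0" "cform w w = 0" "cform v w = 0"
    using divisor_orthogonal_center[OF d(1) _ nonab] divisor_orthogonal_center[OF d(2) _ nonab] c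
    by blast+
  obtain u where u: "cform u u = 0" "cform (w - v) (w - v) = 0" "cform u (w - v) = 0"
    "siegel_map u (w - v) v = w"
    using siegel_direction_exists[of v w] v False orth unfolding central_divisor_def by metis
  have "siegel_map u (w - v) (br x y) = br (siegel_map u (w - v) x) (siegel_map u (w - v) y)" for x y
    using d c u by (intro siegel_map_automorphism[OF q]) (simp_all add: divisor_diff quadratic_structure_simps[OF q])
  then show ?thesis
    using u(4) siegel_map_orthogonal[OF u(1-3)] by (intro that[of "siegel_map u (w - v)" 1]) simp_all
qed

section \<open>Central divisors in solvable singular structures\<close>

text \<open>
  The contraction of \<open>v\<^sup>\<flat> \<and> I = 0\<close> with \<open>u\<close> reads \<open>I = v\<^sup>\<flat> \<and> \<iota>\<^sub>u I\<close>: one inner derivation determines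
  the bracket.
\<close>

lemma divisor_bracket:
  assumes "divides_assoc_form br v" and u: "cform v u = 1"
  shows "br y z = cform v y *s br u z - cform v z *s br u y + cform (br u y) z *s v"
proof (rule cform_eqI)
  fix w
  have "cform (br y z) w - cform v y * cform (br u z) w
      + cform v z * cform (br u y) w - cform v w * cform (br u y) z = 0"
    using divisor_cform[OF assms(1), of u y z w] by (simp add: u)
  then show "cform (br y z) w
      = cform (cform v y *s br u z - cform v z *s br u y + cform (br u y) z *s v) w"
    unfolding cform_simps by algebra
qed

text \<open>
  The inner derivation \<open>ad t\<close> is skew and annihilates \<open>I\<close>, so its action on \<open>v\<^sup>\<flat> \<and> I = 0\<close> gives
  \<open>[t, v]\<^sup>\<flat> \<and> I = 0\<close>.
\<close>

lemma divisor_ad: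
  assumes q: "quadratic_structure br" and d: "divides_assoc_form br v"
  shows "divides_assoc_form br (br t v)"
  unfolding divides_assoc_form_def wedge13_def assoc_form_def
proof (intro allI)
  fix x y z w
  have tv: "cform (br t v) x = - cform v (br t x)" for x
    using quadratic_structure_invariant[OF q, of v t x] assoc_form_alternating(1)[OF q, of v t x]
    by (metis minus_minus)
  have inv: "cform (br (br t x) y) z + cform (br x (br t y)) z + cform (br x y) (br t z) = 0" for x y z
  proof -
    have "cform (br x y) (br t z) = - cform (br t (br x y)) z"
      using quadratic_structure_invariant[OF q, of "br x y" t z]
        assoc_form_alternating(1)[OF q, of t "br x y" z] by simp
    moreover have "cform (br (br t x) y) z = - cform (br y (br t x)) z"
      by (rule assoc_form_alternating(1)[OF q])
    moreover have "cform (br x (br t y)) z = - cform (br x (br y t)) z"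
      using quadratic_structure_antisym[OF q, of y t] quadratic_structure_simps(3)[OF q, of x "-1"]
      by (simp add: cform_simps)
    moreover have "cform (br t (br x y) + br x (br y t) + br y (br t x)) z = 0"
      by (simp add: quadratic_structure_jacobi[OF q])
    ultimately show ?thesis by (simp add: cform_simps add_eq_0_iff)
  qed
  \<comment> \<open>In \<open>s\<close>, the \<open>y\<^sub>i\<close> are the values of \<open>v\<^sup>\<flat>\<close> at the four vectors, the \<open>x\<^sub>i\<close> those at their brackets with
    \<open>t\<close>, \<open>i\<^sub>j\<close> is \<open>I\<close> without the \<open>j\<close>-th vector, and \<open>j\<^sub>k\<^sub>j\<close> the same with \<open>t\<close> acting on the \<open>k\<close>-th one.\<close>
  have s: "x1 * i1 - x2 * i2 + x3 * i3 - x4 * i4 = 0"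
    if "x1 * i1 - y2 * j12 + y3 * j13 - y4 * j14 = 0" "y1 * j21 - x2 * i2 + y3 * j23 - y4 * j24 = 0"
      "y1 * j31 - y2 * j32 + x3 * i3 - y4 * j34 = 0" "y1 * j41 - y2 * j42 + y3 * j43 - x4 * i4 = 0"
      "j21 + j31 + j41 = 0" "j12 + j32 + j42 = 0" "j13 + j23 + j43 = 0" "j14 + j24 + j34 = 0"
    for x1 x2 x3 x4 y1 y2 y3 y4 i1 i2 i3 i4 j12 j13 j14 j21 j23 j24 j31 j32 j34 j41 j42 j43 :: complex
    using that by algebra
  have "cform v (br t x) * cform (br y z) w - cform v (br t y) * cform (br x z) w
      + cform v (br t z) * cform (br x y) w - cform v (br t w) * cform (br x y) z = 0"
    by (rule s[OF divisor_cform[OF d, of "br t x" y z w] divisor_cform[OF d, of x "br t y" z w]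
        divisor_cform[OF d, of x y "br t z" w] divisor_cform[OF d, of x y z "br t w"]
        inv[of y z w] inv[of x z w] inv[of x y w] inv[of x y z]])
  then show "cform (br t v) x * cform (br y z) w - cform (br t v) y * cform (br x z) w
      + cform (br t v) z * cform (br x y) w - cform (br t v) w * cform (br x y) z = 0"
    unfolding tv by algebra
qed

text \<open>
  If \<open>[y, a] = c(y) a\<close>, then \<open>I(y, a, z) = c(y) B(a, z)\<close> is alternating in \<open>y\<close> and \<open>z\<close>. For \<open>u\<close> with
  \<open>B(a, u) = 1\<close> this gives first \<open>c(u) = 0\<close> and then \<open>c(y) = - c(u) B(a, y) = 0\<close>.
\<close>

lemma central_if_spans_ideal:
  assumes q: "quadratic_structure br" and "a \<noteq> 0" and ideal: "\<And>y. \<exists>c. br y a = c *s a"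
  shows "br a y = 0"
proof -
  obtain u where u: "cform a u = 1" using cform_dual_vector[OF \<open>a \<noteq> 0\<close>] .
  have ua: "br u a = 0"
  proof -
    obtain c where c: "br u a = c *s a" using ideal by blast
    have "cform (br u a) u = 0"
      using assoc_form_alternating(2)[OF q, of u u a] by (simp add: quadratic_structure_simps[OF q])
    with c u show ?thesis by (simp add: cform_simps)
  qed
  obtain c where c: "br y a = c *s a" using ideal by blast
  have "c = cform (br y a) u" by (simp add: c cform_simps u)
  also have "\<dots> = cform (br u y) a" by (rule assoc_form_alternating(3)[OF q, symmetric])
  also have "\<dots> = - cform (br u a) y" by (rule assoc_form_alternating(2)[OF q])
  finally have "c = 0" by (simp add: ua)
  with c quadratic_structure_antisym[OF q, of a y] show ?thesis by simp
qed

text \<open>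
  Two independent divisors make \<open>I\<close> decomposable: \<open>I = a\<^sup>\<flat> \<and> b\<^sup>\<flat> \<and> c\<^sup>\<flat>\<close>, by \<open>divisor_bracket\<close> applied
  to \<open>a\<close> and to \<open>b\<close>. The bracket is then a cross product on \<open>\<langle>a, b, c\<rangle>\<close>.
\<close>

lemma two_divisors_bracket:
  assumes q: "quadratic_structure br"
    and d: "divides_assoc_form br a" "divides_assoc_form br b"
    and u1: "cform a u\<^sub>1 = 1" "cform b u\<^sub>1 = 0" and u2: "cform a u\<^sub>2 = 0" "cform b u\<^sub>2 = 1"
  defines "c \<equiv> br u\<^sub>1 u\<^sub>2"
  shows "br y z = (cform b y * cform c z - cform b z * cform c y) *s a
    + (cform c y * cform a z - cform c z * cform a y) *s b
    + (cform a y * cform b z - cform a z * cform b y) *s c"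
proof -
  have "br u\<^sub>2 u\<^sub>1 = - c" unfolding c_def by (rule quadratic_structure_antisym[OF q])
  then have ad: "br u\<^sub>1 z = cform b z *s c - cform c z *s b" for z
    using divisor_bracket[OF d(2) u2(2), of u\<^sub>1 z] by (simp add: u1 cform_simps vec.scale_minus_right vec.scale_minus_left)
  show ?thesis
    unfolding divisor_bracket[OF d(1) u1(1), of y z] ad cform_simps
    by (simp add: vec_eq_iff algebra_simps)
qed

text \<open>
  Without central divisors, \<open>I = a\<^sup>\<flat> \<and> b\<^sup>\<flat> \<and> c\<^sup>\<flat>\<close> and the Gram matrix of \<open>(a, b, c)\<close> is invertible, as a
  non-zero vector in its kernel would give a central divisor. The span of \<open>a\<close>, \<open>b\<close>, \<open>c\<close> is then a perfect subalgebra, a copy of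
  \<open>\<oo>(3)\<close>, and lies in all terms of the derived series.
\<close>

lemma solvable_singular_central_divisor:
  assumes q: "quadratic_structure br" and nonab: "br x\<^sub>0 y\<^sub>0 \<noteq> 0" and sol: "solvable br"
    and a: "divides_assoc_form br a" "a \<noteq> 0"
  shows "\<exists>v. central_divisor br v"
proof (rule ccontr)
  assume none: "\<not> ?thesis"
  obtain t where t: "\<And>k. br t a \<noteq> k *s a"
    using none central_if_spans_ideal[OF q a(2)] a unfolding central_divisor_def by metis
  define b where "b = br t a"
  have b: "divides_assoc_form br b" unfolding b_def by (rule divisor_ad[OF q a(1)])
  have ind: "b \<noteq> k *s a" for k using t by (simp add: b_def)
  obtain u1 where u1: "cform a u1 = 1" "cform b u1 = 0" using cform_dual_pair[OF a(2) ind] .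
  obtain u2 where u2: "cform a u2 = 0" "cform b u2 = 1" using cform_dual_pair[OF a(2) ind] .
  define c where "c = br u1 u2"
  note bracket = two_divisors_bracket[OF q a(1) b u1 u2, folded c_def]
  have "c \<noteq> 0" using nonab bracket[of x\<^sub>0 y\<^sub>0] by auto
  have c_u: "cform c u1 = 0" "cform c u2 = 0"
    using assoc_form_alternating(2)[OF q, of u1 u1 u2] quadratic_structure_invariant[OF q, of u1 u2 u2]
    by (simp_all add: c_def quadratic_structure_simps[OF q])
  \<comment> \<open>\<open>E\<close> parametrizes \<open>\<langle>a, b, c\<rangle>\<close>, and \<open>f\<close> is multiplication by the Gram matrix.\<close>
  define E :: "complex^3 \<Rightarrow> _" where "E v = v $ 1 *s a + v $ 2 *s b + v $ 3 *s c" for v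
  define f :: "complex^3 \<Rightarrow> complex^3" where
    "f v = vector [cform a (E v), cform b (E v), cform c (E v)]" for v
  have E_lin: "E (v + w) = E v + E w" "E (k *s v) = k *s E v" for v w k
    by (simp_all add: E_def vec_eq_iff algebra_simps)
  have E_div: "divides_assoc_form br (E v)" for v
    unfolding divides_assoc_form_def wedge13_def assoc_form_def E_def cform_simps bracket
    by (simp add: algebra_simps)
  have E_zero: "E v = 0" if "f v = 0" for v
  proof (rule ccontr)
    have "cform a (E v) = 0" "cform b (E v) = 0" "cform c (E v) = 0"
      using that by (simp_all add: f_def vec_eq_iff forall_3 vector_3)
    then have "br (E v) y = 0" for y unfolding bracket[of "E v" y] by simp
    moreover assume "E v \<noteq> 0"
    ultimately have "central_divisor br (E v)" by (simp add: central_divisor_def E_div)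
    with none show False by blast
  qed
  have inj: "v = 0" if "f v = 0" for v
  proof -
    have E0: "E v = 0" by (rule E_zero[OF that])
    have "v $ 1 = cform (E v) u1" "v $ 2 = cform (E v) u2"
      by (simp_all add: E_def cform_simps u1 u2 c_u)
    then have "v $ 1 = 0" "v $ 2 = 0" by (simp_all add: E0)
    moreover from this E0 \<open>c \<noteq> 0\<close> have "v $ 3 = 0" by (simp add: E_def)
    ultimately show ?thesis by (simp add: vec_eq_iff forall_3)
  qed
  have f_lin: "Vector_Spaces.linear (*s) (*s) f"
    by (simp add: linear_cvec_iff f_def E_lin cform_simps vec_eq_iff forall_3 vector_3)
  interpret f: Vector_Spaces.linear "(*s)" "(*s)" f by (rule f_lin)
  have "inj f" using inj by (simp add: f.inj_iff_eq_0)
  then have "surj f" using vec.linear_inj_imp_surj f_lin by blast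
  then have "\<exists>w. cform a (E w) = r \<and> cform b (E w) = s \<and> cform c (E w) = k" for r s k
  proof -
    obtain w where "f w = vector [r, s, k]" using \<open>surj f\<close> by (metis surjD)
    then show ?thesis by (auto simp: f_def vec_eq_iff forall_3 vector_3)
  qed
  then obtain w1 w2 w3 where
    w1: "cform a (E w1) = 1" "cform b (E w1) = 0" "cform c (E w1) = 0" and
    w2: "cform a (E w2) = 0" "cform b (E w2) = 1" "cform c (E w2) = 0" and
    w3: "cform a (E w3) = 0" "cform b (E w3) = 0" "cform c (E w3) = 1"
    by metis
  have perfect: "a = br (E w2) (E w3)" "b = br (E w3) (E w1)" "c = br (E w1) (E w2)"
    using bracket[of "E w2" "E w3"] bracket[of "E w3" "E w1"] bracket[of "E w1" "E w2"]
    by (simp_all add: w1 w2 w3)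
  have "E w \<in> derived_series br k" for w k
  proof (induction k arbitrary: w)
    case (Suc k)
    have "{a, b, c} \<subseteq> derived_series br (Suc k)"
      using Suc.IH perfect by (auto intro!: vec.span_base)
    then show ?case
      by (simp add: E_def vec.span_add vec.span_scale)
  qed simp
  moreover have "E (vector [1, 0, 0]) = a" by (simp add: E_def vector_3)
  ultimately have "a \<in> derived_series br k" for k by metis
  with sol a(2) show False by (auto simp: solvable_def)
qed

section \<open>Singularity in terms of divisors\<close>

text \<open>
  A positive value of \<open>dim\<close> requires a finite basis, which exists because all
  1-forms lie in the span of the \<open>e\<^sup>\<flat>\<close> for unit vectors \<open>e\<close>.
\<close>

lemma dup_pos_iff: "dup br \<ge> 1 \<longleftrightarrow> (\<exists>v. v \<noteq> 0 \<and> divides_assoc_form br v)"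
  for br :: "'m::{finite,linorder} cvec \<Rightarrow> 'm cvec \<Rightarrow> 'm cvec"
proof -
  interpret V: vector_space "scale_form :: complex \<Rightarrow> ('m cvec \<Rightarrow> complex) \<Rightarrow> _"
    by (rule vector_space_scale_form)
  define S where "S = {\<alpha>. Vector_Spaces.linear (*s) (*) \<alpha> \<and>
      (\<forall>x y z w. wedge13 \<alpha> (assoc_form br) x y z w = 0)}"
  have S: "S = cform ` {v. divides_assoc_form br v}"
  proof
    show "S \<subseteq> cform ` {v. divides_assoc_form br v}"
    proof
      fix \<alpha> assume "\<alpha> \<in> S"
      then have "Vector_Spaces.linear (*s) (*) \<alpha>" by (simp add: S_def)
      then obtain a where "\<alpha> = cform a" by (rule functional_representation)
      with \<open>\<alpha> \<in> S\<close> show "\<alpha> \<in> cform ` {v. divides_assoc_form br v}"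
        by (auto simp: S_def divides_assoc_form_def)
    qed
  qed (auto simp: S_def divides_assoc_form_def linear_functional_iff cform_simps)
  interpret L: Vector_Spaces.linear "(*s)" scale_form "cform :: 'm cvec \<Rightarrow> _"
    by (simp add: Vector_Spaces.linear_iff vec.vector_space_axioms V.vector_space_axioms
        scale_form_def fun_eq_iff cform_simps)
  have "range (cform :: 'm cvec \<Rightarrow> _) = V.span (cform ` cart_basis)"
    using L.span_image[of cart_basis] by simp
  then have S_span: "S \<subseteq> V.span (cform ` cart_basis)" using S by auto
  obtain B where B: "B \<subseteq> S" "V.independent B" "S \<subseteq> V.span B" "card B = V.dim S"
    by (rule V.basis_exists)
  have "finite B"
    using V.independent_span_bound[of "cform ` cart_basis" B] B S_span finite_cart_basis by auto
  have "dup br = card B" by (simp add: dup_def B(4) S_def)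
  then have "dup br \<ge> 1 \<longleftrightarrow> B \<noteq> {}" using \<open>finite B\<close> by (simp add: Suc_le_eq card_gt_0_iff)
  also have "\<dots> \<longleftrightarrow> (\<exists>v. v \<noteq> 0 \<and> divides_assoc_form br v)"
  proof
    assume "B \<noteq> {}"
    then obtain \<alpha> where "\<alpha> \<in> B" by blast
    then obtain v where v: "\<alpha> = cform v" "divides_assoc_form br v" using B(1) S by auto
    have "\<alpha> \<noteq> 0" using B(2) \<open>\<alpha> \<in> B\<close> V.dependent_zero by blast
    with v have "v \<noteq> 0" using L.zero by metis
    with v show "\<exists>v. v \<noteq> 0 \<and> divides_assoc_form br v" by blast
  next
    assume "\<exists>v. v \<noteq> 0 \<and> divides_assoc_form br v"
    then obtain v where v: "v \<noteq> 0" "cform v \<in> S" using S by blast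
    show "B \<noteq> {}"
    proof
      assume "B = {}"
      then have "cform v = 0" using B(3) v by auto
      then have "v = 0" by (intro cform_nondegenerate) (simp add: fun_eq_iff)
      with v show False by simp
    qed
  qed
  finally show ?thesis .
qed

section \<open>Isometries of double extensions\<close>

lemma dext_isometries_iff:
  "\<Phi> \<in> dext_isometries \<longleftrightarrow> (\<forall>u v. \<Phi> (u + v) = \<Phi> u + \<Phi> v) \<and>
    (\<forall>c u. \<Phi> (dext_scale c u) = c *s \<Phi> u) \<and> bij \<Phi> \<and> (\<forall>u v. cform (\<Phi> u) (\<Phi> v) = dext_form u v)"
  unfolding dext_isometries_def linear_dext_iff by blast

lemma dext_isometry_simps:
  assumes "\<Phi> \<in> dext_isometries"
  shows "\<Phi> (u + v) = \<Phi> u + \<Phi> v" "\<Phi> (dext_scale c u) = c *s \<Phi> u"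
    "cform (\<Phi> u) (\<Phi> v) = dext_form u v" "inv \<Phi> (\<Phi> u) = u" "\<Phi> (inv \<Phi> x) = x"
    "\<Phi> (0, 0, 0) = 0"
proof -
  note iff = assms[unfolded dext_isometries_iff]
  show "\<Phi> (u + v) = \<Phi> u + \<Phi> v" "\<Phi> (dext_scale c u) = c *s \<Phi> u"
    "cform (\<Phi> u) (\<Phi> v) = dext_form u v" "inv \<Phi> (\<Phi> u) = u" "\<Phi> (inv \<Phi> x) = x"
    using iff by (simp_all add: bij_is_inj bij_is_surj surj_f_inv_f del: split_paired_All)
  have "\<Phi> (dext_scale 0 (0, 0, 0)) = 0 *s \<Phi> (0, 0, 0)" using iff by blast
  then show "\<Phi> (0, 0, 0) = 0" by (simp add: dext_scale_def)
qed

lemma dext_isometry_components: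
  assumes "\<Phi> \<in> dext_isometries"
  shows "\<Phi> (l, m, X) = l *s \<Phi> (1, 0, 0) + m *s \<Phi> (0, 1, 0) + \<Phi> (0, 0, X)"
proof -
  have "(l, m, X) = dext_scale l (1, 0, 0) + dext_scale m (0, 1, 0) + (0, 0, X)"
    by (simp add: dext_scale_def)
  then show ?thesis by (metis dext_isometry_simps(1,2)[OF assms])
qed

text \<open>
  Pairing with \<open>X\<^sub>1\<close> reads off the coefficient of \<open>Y\<^sub>1\<close>.
\<close>

lemma dext_isometry_pairing:
  assumes \<Phi>: "\<Phi> \<in> dext_isometries"
  shows "cform (\<Phi> (1, 0, 0)) x = fst (snd (inv \<Phi> x))"
proof -
  have "cform (\<Phi> (1, 0, 0)) (\<Phi> (inv \<Phi> x)) = dext_form (1, 0, 0) (inv \<Phi> x)"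
    by (rule dext_isometry_simps(3)[OF \<Phi>])
  also have "\<dots> = fst (snd (inv \<Phi> x))"
    by (cases "inv \<Phi> x") (simp add: dext_form_def)
  finally show ?thesis by (simp add: dext_isometry_simps(5)[OF \<Phi>])
qed

lemma dext_isometry_inv_linear:
  assumes \<Phi>: "\<Phi> \<in> dext_isometries"
  shows "inv \<Phi> (x + y) = inv \<Phi> x + inv \<Phi> y" "inv \<Phi> (c *s x) = dext_scale c (inv \<Phi> x)"
proof -
  have "\<Phi> u = \<Phi> v \<Longrightarrow> u = v" for u v using dext_isometry_simps(4)[OF \<Phi>] by metis
  then show "inv \<Phi> (x + y) = inv \<Phi> x + inv \<Phi> y" "inv \<Phi> (c *s x) = dext_scale c (inv \<Phi> x)"
    by (simp_all add: dext_isometry_simps[OF \<Phi>])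
qed

lemma dext_isometries_orthogonal_comp:
  assumes "A \<in> orthogonal_group" "\<Phi> \<in> dext_isometries"
  shows "(\<lambda>u. A (\<Phi> u)) \<in> dext_isometries"
proof -
  have "bij (\<lambda>u. A (\<Phi> u))"
    using bij_comp[of \<Phi> A] orthogonal_group_bij[OF assms(1)] assms(2)
    by (simp add: dext_isometries_def comp_def)
  then show ?thesis
    unfolding dext_isometries_iff using assms
    by (simp add: dext_isometry_simps orthogonal_group_linear orthogonal_group_isometry
        del: split_paired_All)
qed

lemma dext_isometries_quotient:
  assumes \<Phi>: "\<Phi> \<in> dext_isometries" and \<Phi>': "\<Phi>' \<in> dext_isometries"
  shows "(\<lambda>x. \<Phi>' (inv \<Phi> x)) \<in> orthogonal_group"
proof (rule orthogonal_groupI)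
  show "Vector_Spaces.linear (*s) (*s) (\<lambda>x. \<Phi>' (inv \<Phi> x))"
    by (simp add: linear_cvec_iff dext_isometry_inv_linear[OF \<Phi>] dext_isometry_simps[OF \<Phi>'])
  show "cform (\<Phi>' (inv \<Phi> x)) (\<Phi>' (inv \<Phi> y)) = cform x y" for x y
    using dext_isometry_simps(3)[OF \<Phi>, of "inv \<Phi> x" "inv \<Phi> y"]
    by (simp add: dext_isometry_simps[OF \<Phi>] dext_isometry_simps(3)[OF \<Phi>'])
qed

text \<open>
  The isometries of the double extension that extend \<open>U\<close> and preserve the lines of \<open>X\<^sub>1\<close> and \<open>Y\<^sub>1\<close>.
\<close>

definition dext_rescale ::
  "complex \<Rightarrow> ('n::finite cvec \<Rightarrow> 'n cvec) \<Rightarrow> 'n dext_space \<Rightarrow> 'n dext_space" where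
  "dext_rescale k U = (\<lambda>(l, m, X). (k * l, m / k, U X))"

lemma dext_isometries_rescale:
  assumes \<Phi>: "\<Phi> \<in> dext_isometries" and U: "U \<in> orthogonal_group" and k: "k \<noteq> 0"
  shows "(\<lambda>u. \<Phi> (dext_rescale k U u)) \<in> dext_isometries"
proof -
  have "bij (dext_rescale k U)"
  proof (rule bij_betw_byWitness[where f' = "dext_rescale (1 / k) (inv U)"])
  qed (use k in \<open>auto simp: dext_rescale_def orthogonal_group_inv_simps[OF U]\<close>)
  then have "bij (\<lambda>u. \<Phi> (dext_rescale k U u))"
    using bij_comp[of "dext_rescale k U" \<Phi>] \<Phi> by (simp add: dext_isometries_def comp_def)
  moreover have "dext_rescale k U (u + v) = dext_rescale k U u + dext_rescale k U v" for u v
    by (cases u; cases v) (simp add: dext_rescale_def orthogonal_group_linear[OF U] algebra_simps add_divide_distrib)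
  moreover have "dext_rescale k U (dext_scale c u) = dext_scale c (dext_rescale k U u)" for c u
    by (cases u) (simp add: dext_rescale_def dext_scale_def orthogonal_group_linear[OF U])
  moreover have "dext_form (dext_rescale k U u) (dext_rescale k U v) = dext_form u v" for u v
    using k by (cases u; cases v) (simp add: dext_rescale_def dext_form_def orthogonal_group_isometry[OF U])
  ultimately show ?thesis
    unfolding dext_isometries_iff by (simp add: dext_isometry_simps[OF \<Phi>] del: split_paired_All)
qed

text \<open>
  A case of Witt's theorem. The image \<open>e\<close> of \<open>X\<^sub>1\<close> under one fixed isometry is moved to \<open>v\<close> by a rescaling if
  \<open>e\<close> and \<open>v\<close> are proportional, by a Siegel map if they are independent and orthogonal, and by a
  reflection if \<open>B(e, v) \<noteq> 0\<close>.
\<close>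

lemma isotropic_extends_to_dext_isometry:
  fixes v :: "'m::{finite,linorder} cvec"
  assumes card: "CARD('m) = CARD('n::{finite,linorder}) + 2" and v: "v \<noteq> 0" "cform v v = 0"
  obtains \<Phi> :: "'n::{finite,linorder} dext_space \<Rightarrow> 'm cvec" where "\<Phi> \<in> dext_isometries" "\<Phi> (1, 0, 0) = v"
proof -
  obtain \<Psi> :: "'n dext_space \<Rightarrow> 'm cvec" where \<Psi>: "\<Psi> \<in> dext_isometries"
    using dext_isometries_nonempty[OF card] by blast
  define e where "e = \<Psi> (1, 0, 0)"
  have "cform e (\<Psi> (0, 1, 0)) = 1"
    by (simp add: e_def dext_isometry_simps(3)[OF \<Psi>] dext_form_def)
  then have e: "e \<noteq> 0" by auto
  have ee: "cform e e = 0"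
    by (simp add: e_def dext_isometry_simps(3)[OF \<Psi>] dext_form_def)
  consider c where "v = c *s e" | "\<And>c. v \<noteq> c *s e" "cform e v = 0" | "cform e v \<noteq> 0"
    by blast
  then show ?thesis
  proof cases
    case 1
    with v have "c \<noteq> 0" by auto
    then have "(\<lambda>u. \<Psi> (dext_rescale c (\<lambda>x. x) u)) \<in> dext_isometries"
      by (intro dext_isometries_rescale \<Psi> orthogonal_group_id)
    moreover have "\<Psi> (dext_rescale c (\<lambda>x. x) (1, 0, 0)) = v"
      using dext_isometry_simps(2)[OF \<Psi>, of c "(1, 0, 0)"]
      by (simp add: 1 e_def dext_rescale_def dext_scale_def)
    ultimately show ?thesis by (rule that)
  next
    case 2
    obtain u where "cform u u = 0" "cform (v - e) (v - e) = 0" "cform u (v - e) = 0"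
      "siegel_map u (v - e) e = v"
      using siegel_direction_exists[OF e 2(1) ee v(2) 2(2)] .
    then show ?thesis
      using that[OF dext_isometries_orthogonal_comp[OF siegel_map_orthogonal \<Psi>]]
      unfolding e_def by metis
  next
    case 3
    obtain T where "T \<in> orthogonal_group" "T e = v"
      using reflection_moves_isotropic[OF ee v(2) 3] .
    then show ?thesis
      using that[OF dext_isometries_orthogonal_comp[OF _ \<Psi>]] unfolding e_def by metis
  qed
qed

section \<open>Double extensions are solvable and singular\<close>

lemma skew_map_simps:
  assumes "C \<in> skew_maps"
  shows "C (x + y) = C x + C y" "C (c *s x) = c *s C x" "C (x - y) = C x - C y" "C 0 = 0"
    "cform x (C y) = - cform (C x) y"
proof -
  interpret C: Vector_Spaces.linear "(*s)" "(*s)" C using assms by (simp add: skew_maps_def)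
  show "C (x + y) = C x + C y" "C (c *s x) = c *s C x" "C (x - y) = C x - C y" "C 0 = 0"
    by (simp_all add: C.add C.scale C.diff C.zero)
  show "cform x (C y) = - cform (C x) y" using assms by (simp add: skew_maps_def)
qed

lemma dext_structure_apply:
  assumes "\<Phi> \<in> dext_isometries"
  shows "dext_structure \<Phi> C (\<Phi> u) (\<Phi> v) = \<Phi> (dext_bracket C u v)"
  by (simp add: dext_structure_def dext_isometry_simps[OF assms])

lemma dext_structure_quadratic:
  assumes \<Phi>: "\<Phi> \<in> dext_isometries" and C: "C \<in> skew_maps"
  shows "quadratic_structure (dext_structure \<Phi> C)"
proof -
  note \<Phi>_simps = dext_isometry_simps[OF \<Phi>]
  have self: "cform (C x) x = 0" for x
    using skew_map_simps(5)[OF C, of x x] cform_commute[of x "C x"] by simp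
  have square: "cform (C (C x)) y = cform (C (C y)) x" for x y
    using skew_map_simps(5)[OF C, of "C x" y] skew_map_simps(5)[OF C, of "C y" x]
      cform_commute[of "C x" "C y"] by simp
  have add_r: "dext_bracket C u (v + w) = dext_bracket C u v + dext_bracket C u w" for u v w
    by (cases u; cases v; cases w)
      (simp add: dext_bracket_def skew_map_simps[OF C] cform_simps vec_eq_iff algebra_simps)
  have add_l: "dext_bracket C (v + w) u = dext_bracket C v u + dext_bracket C w u" for u v w
    by (cases u; cases v; cases w)
      (simp add: dext_bracket_def skew_map_simps[OF C] cform_simps vec_eq_iff algebra_simps)
  have scale_r: "dext_bracket C u (dext_scale c v) = dext_scale c (dext_bracket C u v)" for u v c
    by (cases u; cases v)
      (simp add: dext_bracket_def dext_scale_def skew_map_simps[OF C] cform_simps vec_eq_iff algebra_simps)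
  have scale_l: "dext_bracket C (dext_scale c u) v = dext_scale c (dext_bracket C u v)" for u v c
    by (cases u; cases v)
      (simp add: dext_bracket_def dext_scale_def skew_map_simps[OF C] cform_simps vec_eq_iff algebra_simps)
  have alt: "dext_bracket C u u = (0, 0, 0)" for u
    by (cases u) (simp add: dext_bracket_def self)
  have jac: "dext_bracket C u (dext_bracket C v w) + dext_bracket C v (dext_bracket C w u)
      + dext_bracket C w (dext_bracket C u v) = (0, 0, 0)" for u v w
  proof -
    obtain l m X where u: "u = (l, m, X)" by (cases u)
    obtain l' m' Y where v: "v = (l', m', Y)" by (cases v)
    obtain l'' m'' Z where w: "w = (l'', m'', Z)" by (cases w)
    show ?thesis
      unfolding u v w
      by (simp add: dext_bracket_def skew_map_simps[OF C] cform_simps square[of Y X]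
          square[of Z X] square[of Z Y] vec_eq_iff algebra_simps)
  qed
  have inv: "dext_form (dext_bracket C u v) w = dext_form u (dext_bracket C v w)" for u v w
  proof -
    obtain l m X where u: "u = (l, m, X)" by (cases u)
    obtain l' m' Y where v: "v = (l', m', Y)" by (cases v)
    obtain l'' m'' Z where w: "w = (l'', m'', Z)" by (cases w)
    show ?thesis
      unfolding u v w
      by (simp add: dext_bracket_def dext_form_def skew_map_simps[OF C] cform_simps algebra_simps)
  qed
  have "lie_bracket (dext_structure \<Phi> C)"
    unfolding lie_bracket_def linear_cvec_iff dext_structure_def
    by (simp add: dext_isometry_inv_linear[OF \<Phi>] add_r add_l scale_r scale_l alt \<Phi>_simps(1,2,4-)
        \<Phi>_simps(1)[symmetric] jac del: \<Phi>_simps(1))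
  moreover have "cform (dext_structure \<Phi> C x y) z = cform x (dext_structure \<Phi> C y z)" for x y z
  proof -
    have "cform (\<Phi> (dext_bracket C (inv \<Phi> x) (inv \<Phi> y))) (\<Phi> (inv \<Phi> z))
        = cform (\<Phi> (inv \<Phi> x)) (\<Phi> (dext_bracket C (inv \<Phi> y) (inv \<Phi> z)))"
      by (simp only: \<Phi>_simps(3) inv)
    then show ?thesis by (simp add: dext_structure_def \<Phi>_simps(5))
  qed
  ultimately show ?thesis by (simp add: quadratic_structure_def)
qed

lemma dext_structure_nonabelian:
  assumes \<Phi>: "\<Phi> \<in> dext_isometries" and C: "C \<in> skew_maps - {0}"
  obtains x y where "dext_structure \<Phi> C x y \<noteq> 0"
proof -
  have C': "C \<in> skew_maps" using C by simp
  obtain Y where "C Y \<noteq> 0" using C by (auto simp: fun_eq_iff)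
  then obtain Z where Z: "cform (C Y) Z \<noteq> 0" using cform_nondegenerate by blast
  have "dext_structure \<Phi> C (\<Phi> (0, 1, 0)) (\<Phi> (0, 0, Y)) = \<Phi> (0, 0, C Y)"
    by (simp add: dext_structure_apply[OF \<Phi>] dext_bracket_def skew_map_simps[OF C'])
  moreover have "cform (\<Phi> (0, 0, C Y)) (\<Phi> (0, 0, Z)) \<noteq> 0"
    using Z by (simp add: dext_isometry_simps(3)[OF \<Phi>] dext_form_def)
  ultimately show ?thesis using that cform_zero_left by metis
qed

lemma dext_structure_central_divisor:
  assumes \<Phi>: "\<Phi> \<in> dext_isometries" and C: "C \<in> skew_maps"
  shows "central_divisor (dext_structure \<Phi> C) (\<Phi> (1, 0, 0))"
proof -
  note form = dext_isometry_pairing[OF \<Phi>]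
  have assoc: "assoc_form (dext_structure \<Phi> C) x y z
      = dext_form (dext_bracket C (inv \<Phi> x) (inv \<Phi> y)) (inv \<Phi> z)" for x y z
    using dext_isometry_simps(3)[OF \<Phi>, of _ "inv \<Phi> z"]
    by (simp add: assoc_form_def dext_structure_def dext_isometry_simps[OF \<Phi>])
  have swap: "cform (C x) y = - cform (C y) x" for x y
    using skew_map_simps(5)[OF C, of y x] cform_commute[of y "C x"] by simp
  have "divides_assoc_form (dext_structure \<Phi> C) (\<Phi> (1, 0, 0))"
    unfolding divides_assoc_form_def wedge13_def form assoc
  proof (intro allI)
    fix x y z w
    obtain l1 m1 X where x: "inv \<Phi> x = (l1, m1, X)" by (cases "inv \<Phi> x")
    obtain l2 m2 Y where y: "inv \<Phi> y = (l2, m2, Y)" by (cases "inv \<Phi> y")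
    obtain l3 m3 Z where z: "inv \<Phi> z = (l3, m3, Z)" by (cases "inv \<Phi> z")
    obtain l4 m4 W where w: "inv \<Phi> w = (l4, m4, W)" by (cases "inv \<Phi> w")
    show "fst (snd (inv \<Phi> x)) * dext_form (dext_bracket C (inv \<Phi> y) (inv \<Phi> z)) (inv \<Phi> w)
      - fst (snd (inv \<Phi> y)) * dext_form (dext_bracket C (inv \<Phi> x) (inv \<Phi> z)) (inv \<Phi> w)
      + fst (snd (inv \<Phi> z)) * dext_form (dext_bracket C (inv \<Phi> x) (inv \<Phi> y)) (inv \<Phi> w)
      - fst (snd (inv \<Phi> w)) * dext_form (dext_bracket C (inv \<Phi> x) (inv \<Phi> y)) (inv \<Phi> z) = 0"
      by (simp add: x y z w dext_form_def dext_bracket_def cform_simps swap[of Y X] swap[of Z X]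
          swap[of Z Y] algebra_simps)
  qed
  moreover have "dext_structure \<Phi> C (\<Phi> (1, 0, 0)) x = 0" for x
    by (cases "inv \<Phi> x")
      (simp add: dext_structure_def dext_isometry_simps[OF \<Phi>] dext_bracket_def skew_map_simps[OF C])
  moreover have "\<Phi> (1, 0, 0) \<noteq> 0"
  proof -
    have "cform (\<Phi> (1, 0, 0)) (\<Phi> (0, 1, 0)) = 1"
      by (simp add: dext_isometry_simps(3)[OF \<Phi>] dext_form_def)
    then show ?thesis by auto
  qed
  ultimately show ?thesis by (simp add: central_divisor_def)
qed

text \<open>
  The derived algebra is orthogonal to the central vector \<open>X\<^sub>1\<close>, and two vectors orthogonal to \<open>X\<^sub>1\<close>
  have their bracket in \<open>\<complex>X\<^sub>1\<close>. So the derived series vanishes from the third step on.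
\<close>

lemma dext_structure_solvable:
  assumes \<Phi>: "\<Phi> \<in> dext_isometries" and C: "C \<in> skew_maps"
  shows "solvable (dext_structure \<Phi> C)"
proof -
  define br where "br = dext_structure \<Phi> C"
  define v where "v = \<Phi> (1, 0, 0)"
  have q: "quadratic_structure br" unfolding br_def by (rule dext_structure_quadratic[OF \<Phi> C])
  have central: "br v x = 0" for x
    using dext_structure_central_divisor[OF \<Phi> C] by (simp add: central_divisor_def br_def v_def)
  have subspace: "vec.subspace {x. cform v x = 0}"
    by (simp add: vec.subspace_def cform_simps)
  note form = dext_isometry_pairing[OF \<Phi>, folded v_def]
  have D1: "derived_series br (Suc 0) \<subseteq> {x. cform v x = 0}"
    unfolding derived_series.simps
  proof (rule vec.span_minimal[OF _ subspace], clarsimp)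
    fix x y
    show "cform v (br x y) = 0"
      using quadratic_structure_invariant[OF q, of v x y] by (simp add: central)
  qed
  have D2: "derived_series br (Suc (Suc 0)) \<subseteq> vec.span {v}"
    unfolding derived_series.simps(2)[of br "Suc 0"]
  proof (rule vec.span_minimal[OF _ vec.subspace_span], safe)
    fix x y assume "x \<in> derived_series br (Suc 0)" "y \<in> derived_series br (Suc 0)"
    then have xy: "cform v x = 0" "cform v y = 0" using D1 by auto
    obtain l m X where x: "inv \<Phi> x = (l, m, X)" by (cases "inv \<Phi> x")
    obtain l' m' Y where y: "inv \<Phi> y = (l', m', Y)" by (cases "inv \<Phi> y")
    have "br x y = \<Phi> (dext_scale (cform (C X) Y) (1, 0, 0))"
      using xy unfolding form by (simp add: br_def dext_structure_def x y dext_bracket_def dext_scale_def)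
    also have "\<dots> = cform (C X) Y *s v" by (simp only: dext_isometry_simps(2)[OF \<Phi>] v_def)
    finally show "br x y \<in> vec.span {v}" by (simp add: vec.span_scale vec.span_base)
  qed
  have "derived_series br (Suc (Suc (Suc 0))) \<subseteq> {0}"
    unfolding derived_series.simps(2)[of br "Suc (Suc 0)"]
  proof (rule vec.span_minimal, safe)
    fix x y assume "x \<in> derived_series br (Suc (Suc 0))"
    then have "x \<in> vec.span {v}" using D2 by blast
    then obtain c where "x = c *s v" by (auto simp: vec.span_singleton)
    then show "br x y = 0" by (simp add: quadratic_structure_simps[OF q] central)
  qed (simp add: vec.subspace_def)
  moreover have "0 \<in> derived_series br (Suc (Suc (Suc 0)))" by (simp add: vec.span_zero)
  ultimately show ?thesis unfolding solvable_def br_def[symmetric] by blast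
qed

lemma dext_structure_solvable_singular:
  assumes \<Phi>: "\<Phi> \<in> dext_isometries" and C: "C \<in> skew_maps - {0}"
  shows "dext_structure \<Phi> C \<in> solvable_singular_structures"
proof -
  have C': "C \<in> skew_maps" using C by simp
  show ?thesis
    using dext_structure_quadratic[OF \<Phi> C'] dext_structure_solvable[OF \<Phi> C']
      dext_structure_nonabelian[OF \<Phi> C] dext_structure_central_divisor[OF \<Phi> C']
    unfolding solvable_singular_structures_def singular_def dup_pos_iff central_divisor_def
    by blast
qed

section \<open>Recovering the skew map from the bracket\<close>

text \<open>
  With \<open>u = \<Phi>(Y\<^sub>1)\<close> and \<open>v = \<Phi>(X\<^sub>1)\<close>: the image of \<open>ad u\<close> is orthogonal to \<open>u\<close> because \<open>[u, u] = 0\<close>, and to \<open>v\<close>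
  because \<open>v\<close> is central. So \<open>ad u\<close> acts on \<open>\<complex>\<^sup>n\<close>, as the map \<open>C\<close>, and \<open>divisor_bracket\<close> expresses the
  bracket by \<open>C\<close>.
\<close>

lemma central_divisor_dext_structure:
  fixes \<Phi> :: "'n::{finite,linorder} dext_space \<Rightarrow> 'm::{finite,linorder} cvec"
  assumes q: "quadratic_structure br" and nonab: "br x\<^sub>0 y\<^sub>0 \<noteq> 0"
    and \<Phi>: "\<Phi> \<in> dext_isometries" and v: "central_divisor br (\<Phi> (1, 0, 0))"
  obtains C where "C \<in> skew_maps - {0}" "br = dext_structure \<Phi> C"
proof -
  define u where "u = \<Phi> (0, 1, 0)"
  define v where "v = \<Phi> (1, 0, 0)"
  define C where "C X = snd (snd (inv \<Phi> (br u (\<Phi> (0, 0, X)))))" for X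
  have central: "br v x = 0" and divides: "divides_assoc_form br v" for x
    using assms(4) by (simp_all add: central_divisor_def v_def)
  have central': "br x v = 0" for x
    using quadratic_structure_antisym[OF q, of x v] by (simp add: central)
  have uu: "cform (br u x) u = 0" for x
    using assoc_form_alternating(2)[OF q, of u u x] by (simp add: quadratic_structure_simps[OF q])
  have ad: "br u (\<Phi> (0, 0, X)) = \<Phi> (0, 0, C X)" for X
  proof -
    define w where "w = inv \<Phi> (br u (\<Phi> (0, 0, X)))"
    obtain l m Y where w: "w = (l, m, Y)" by (cases w)
    have \<Phi>w: "\<Phi> w = br u (\<Phi> (0, 0, X))" by (simp add: w_def dext_isometry_simps(5)[OF \<Phi>])
    have "l = dext_form w (0, 1, 0)" by (simp add: w dext_form_def)
    also have "\<dots> = cform (\<Phi> w) u" by (simp add: u_def dext_isometry_simps(3)[OF \<Phi>])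
    also have "\<dots> = 0" by (simp add: \<Phi>w uu)
    finally have l: "l = 0" .
    have "m = dext_form w (1, 0, 0)" by (simp add: w dext_form_def)
    also have "\<dots> = cform (\<Phi> w) v" by (simp add: v_def dext_isometry_simps(3)[OF \<Phi>])
    also have "\<dots> = 0" by (simp add: \<Phi>w quadratic_structure_invariant[OF q] central')
    finally have m: "m = 0" .
    have "C X = Y" by (simp add: C_def w_def[symmetric] w)
    with \<Phi>w show ?thesis by (simp add: w l m)
  qed
  have ad': "br u (\<Phi> (l, m, X)) = \<Phi> (0, 0, C X)" for l m X
    unfolding dext_isometry_components[OF \<Phi>, of l m X]
    by (simp add: quadratic_structure_simps[OF q] ad central' u_def[symmetric] v_def[symmetric])
  have vu: "cform v u = 1" by (simp add: v_def u_def dext_isometry_simps(3)[OF \<Phi>] dext_form_def)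
  have form: "cform v (\<Phi> (l, m, X)) = m" for l m X
    by (simp add: v_def dext_isometry_simps(3)[OF \<Phi>] dext_form_def)
  have br: "br (\<Phi> a) (\<Phi> b) = \<Phi> (dext_bracket C a b)" for a b
  proof -
    obtain l m X where a: "a = (l, m, X)" by (cases a)
    obtain l' m' Y where b: "b = (l', m', Y)" by (cases b)
    have "dext_bracket C a b = dext_scale m (0, 0, C Y) + dext_scale (- m') (0, 0, C X)
        + dext_scale (cform (C X) Y) (1, 0, 0)"
      by (simp add: a b dext_bracket_def dext_scale_def vec_eq_iff)
    then have "\<Phi> (dext_bracket C a b) = m *s \<Phi> (0, 0, C Y) + (- m') *s \<Phi> (0, 0, C X) + cform (C X) Y *s v"
      by (simp only: dext_isometry_simps(1,2)[OF \<Phi>] v_def)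
    moreover have "cform (\<Phi> (0, 0, C X)) (\<Phi> b) = cform (C X) Y"
      by (simp add: dext_isometry_simps(3)[OF \<Phi>] dext_form_def b)
    ultimately show ?thesis
      unfolding divisor_bracket[OF divides vu, of "\<Phi> a" "\<Phi> b"]
      by (simp add: a b ad' form vec.scale_minus_left)
  qed
  have eq: "br = dext_structure \<Phi> C"
  proof (intro ext)
    fix x y
    show "br x y = dext_structure \<Phi> C x y"
      using br[of "inv \<Phi> x" "inv \<Phi> y"] by (simp add: dext_structure_def dext_isometry_simps(5)[OF \<Phi>])
  qed
  have "Vector_Spaces.linear (*s) (*s) C"
  proof -
    have C: "\<Phi> (0, 0, C X) = \<Phi> (0, 0, Y) \<Longrightarrow> C X = Y" for X Y
      using dext_isometry_simps(4)[OF \<Phi>] by (metis prod.inject)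
    have add: "\<Phi> (0, 0, X + Y) = \<Phi> (0, 0, X) + \<Phi> (0, 0, Y)" for X Y
      using dext_isometry_simps(1)[OF \<Phi>, of "(0, 0, X)" "(0, 0, Y)"] by simp
    have scale: "\<Phi> (0, 0, c *s X) = c *s \<Phi> (0, 0, X)" for c X
      using dext_isometry_simps(2)[OF \<Phi>, of c "(0, 0, X)"] by (simp add: dext_scale_def)
    show ?thesis
      unfolding linear_cvec_iff
      by (intro conjI allI; rule C)
        (simp_all add: add scale ad[symmetric] quadratic_structure_simps[OF q])
  qed
  moreover have "cform (C X) Y = - cform X (C Y)" for X Y
  proof -
    have "cform (\<Phi> (0, 0, C X)) (\<Phi> (0, 0, Y)) = - cform (\<Phi> (0, 0, C Y)) (\<Phi> (0, 0, X))"
      unfolding ad[symmetric] by (rule assoc_form_alternating(2)[OF q])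
    then show ?thesis
      by (simp add: dext_isometry_simps(3)[OF \<Phi>] dext_form_def cform_commute[of X])
  qed
  moreover have "C \<noteq> 0"
  proof
    assume "C = 0"
    then have "br x\<^sub>0 y\<^sub>0 = 0"
      by (simp add: eq dext_structure_def dext_bracket_def dext_isometry_simps(6)[OF \<Phi>] split: prod.split)
    with nonab show False by simp
  qed
  ultimately have "C \<in> skew_maps - {0}" by (simp add: skew_maps_def)
  from this eq show ?thesis by (rule that)
qed

text \<open>
  \<open>\<Theta> = \<Phi>\<^sub>2\<inverse> \<Phi>\<^sub>1\<close> is an isometric isomorphism between the double extensions that maps \<open>X\<^sub>1\<close> to \<open>k X\<^sub>1\<close>.
  It therefore preserves \<open>X\<^sub>1\<^sup>\<bottom>\<close> and multiplies the coefficient of \<open>Y\<^sub>1\<close> by \<open>1 / k\<close>. The map \<open>U\<close>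
  is the one induced on \<open>X\<^sub>1\<^sup>\<bottom> / \<complex>X\<^sub>1\<close>, and \<open>\<Theta>\<close> applied to \<open>[Y\<^sub>1, Y] = C(Y)\<close> gives the relation.
\<close>

lemma dext_structure_eq_imp_conjugate:
  fixes \<Phi>\<^sub>1 \<Phi>\<^sub>2 :: "'n::{finite,linorder} dext_space \<Rightarrow> 'm::{finite,linorder} cvec"
  assumes \<Phi>1: "\<Phi>\<^sub>1 \<in> dext_isometries" and \<Phi>2: "\<Phi>\<^sub>2 \<in> dext_isometries"
    and C: "C \<in> skew_maps"
    and eq: "dext_structure \<Phi>\<^sub>1 C = dext_structure \<Phi>\<^sub>2 C'"
    and k: "k \<noteq> 0" "\<Phi>\<^sub>1 (1, 0, 0) = k *s \<Phi>\<^sub>2 (1, 0, 0)"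
  obtains U where "U \<in> orthogonal_group" "\<And>Y. C' (U Y) = k *s U (C Y)"
proof -
  define \<Theta> where "\<Theta> a = inv \<Phi>\<^sub>2 (\<Phi>\<^sub>1 a)" for a
  have \<Phi>\<Theta>: "\<Phi>\<^sub>2 (\<Theta> a) = \<Phi>\<^sub>1 a" for a by (simp add: \<Theta>_def dext_isometry_simps(5)[OF \<Phi>2])
  have \<Theta>_add: "\<Theta> (a + b) = \<Theta> a + \<Theta> b" and \<Theta>_scale: "\<Theta> (dext_scale c a) = dext_scale c (\<Theta> a)" for a b c
    unfolding \<Theta>_def dext_isometry_simps(1,2)[OF \<Phi>1] dext_isometry_inv_linear[OF \<Phi>2] by simp_all
  have \<Theta>_form: "dext_form (\<Theta> a) (\<Theta> b) = dext_form a b" for a b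
    by (metis \<Phi>\<Theta> dext_isometry_simps(3)[OF \<Phi>1] dext_isometry_simps(3)[OF \<Phi>2])
  have \<Theta>_bracket: "\<Theta> (dext_bracket C a b) = dext_bracket C' (\<Theta> a) (\<Theta> b)" for a b
  proof -
    have "\<Phi>\<^sub>1 (dext_bracket C a b) = \<Phi>\<^sub>2 (dext_bracket C' (\<Theta> a) (\<Theta> b))"
      using dext_structure_apply[OF \<Phi>1, of C a b] dext_structure_apply[OF \<Phi>2, of C' "\<Theta> a" "\<Theta> b"]
      by (simp add: eq \<Phi>\<Theta>)
    then show ?thesis by (simp add: \<Theta>_def dext_isometry_simps(4)[OF \<Phi>2])
  qed
  have \<Theta>_X: "\<Theta> (1, 0, 0) = (k, 0, 0)"
    unfolding \<Theta>_def k(2) dext_isometry_inv_linear[OF \<Phi>2] dext_isometry_simps(4)[OF \<Phi>2]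
    by (simp add: dext_scale_def)
  have \<Theta>_m: "fst (snd (\<Theta> a)) = fst (snd a) / k" for a
    using \<Theta>_form[of a "(1, 0, 0)"] k(1) unfolding \<Theta>_X
    by (cases a; cases "\<Theta> a") (simp add: dext_form_def field_simps)
  define U where "U Y = snd (snd (\<Theta> (0, 0, Y)))" for Y
  define h where "h Y = fst (\<Theta> (0, 0, Y))" for Y
  have \<Theta>_E: "\<Theta> (0, 0, Y) = (h Y, 0, U Y)" for Y
    using \<Theta>_m[of "(0, 0, Y)"] by (simp add: U_def h_def prod_eq_iff)
  have "U \<in> orthogonal_group"
  proof (rule orthogonal_groupI)
    have "U (X + Y) = U X + U Y" for X Y
      using \<Theta>_add[of "(0, 0, X)" "(0, 0, Y)"] by (simp add: \<Theta>_E)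
    moreover have "U (c *s X) = c *s U X" for c X
      using \<Theta>_scale[of c "(0, 0, X)"] by (simp add: \<Theta>_E dext_scale_def)
    ultimately show "Vector_Spaces.linear (*s) (*s) U" by (simp add: linear_cvec_iff)
    show "cform (U X) (U Y) = cform X Y" for X Y
      using \<Theta>_form[of "(0, 0, X)" "(0, 0, Y)"] by (simp add: \<Theta>_E dext_form_def)
  qed
  moreover have "C' (U Y) = k *s U (C Y)" for Y
  proof -
    obtain l Z where Y1: "\<Theta> (0, 1, 0) = (l, 1 / k, Z)"
      using \<Theta>_m[of "(0, 1, 0)"] by (cases "\<Theta> (0, 1, 0)") auto
    have "\<Theta> (0, 0, C Y) = dext_bracket C' (l, 1 / k, Z) (h Y, 0, U Y)"
      using \<Theta>_bracket[of "(0, 1, 0)" "(0, 0, Y)"]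
      by (simp add: dext_bracket_def skew_map_simps[OF C] Y1 \<Theta>_E)
    then have "U (C Y) = (1 / k) *s C' (U Y)" by (simp add: \<Theta>_E dext_bracket_def)
    then show ?thesis using k(1) by simp
  qed
  ultimately show ?thesis by (rule that)
qed

section \<open>Orbits and i-isomorphism classes\<close>

lemma conj_map_comp:
  assumes "U \<in> orthogonal_group" "V \<in> orthogonal_group"
  shows "conj_map V (conj_map U C) = conj_map (\<lambda>x. V (U x)) C"
proof -
  have "inv (\<lambda>x. V (U x)) = (\<lambda>x. inv U (inv V x))"
    using o_inv_distrib[OF orthogonal_group_bij[OF assms(2)] orthogonal_group_bij[OF assms(1)]]
    by (simp add: comp_def)
  then show ?thesis by (simp add: conj_map_def comp_def)
qed

lemma orbit_line_eq_iff:
  assumes "C' \<noteq> 0"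
  shows "orbit (line C) = orbit (line C') \<longleftrightarrow>
    (\<exists>U \<in> orthogonal_group. \<exists>k. k \<noteq> 0 \<and> (\<forall>x. C' (U x) = k *s U (C x)))"
proof
  assume eq: "orbit (line C) = orbit (line C')"
  have "conj_map (\<lambda>x. x) ` line C' = line C'"
    by (simp add: conj_map_def comp_def inv_id[unfolded id_def])
  then have "line C' \<in> orbit (line C')"
    unfolding orbit_def using orthogonal_group_id by blast
  then obtain U where U: "U \<in> orthogonal_group" and line: "line C' = conj_map U ` line C"
    unfolding eq[symmetric] unfolding orbit_def by blast
  have "(\<lambda>x. 1 *s C' x) \<in> line C'" unfolding line_def by blast
  then have "C' \<in> conj_map U ` line C" by (simp add: line)
  then obtain k where C': "C' = conj_map U (\<lambda>x. k *s C x)" by (auto simp: line_def)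
  then have "C' (U x) = k *s U (C x)" for x
    by (simp add: conj_map_def orthogonal_group_inv_simps[OF U] orthogonal_group_linear[OF U])
  moreover have "k \<noteq> 0"
  proof
    assume "k = 0"
    then have "C' = 0"
      by (simp add: C' conj_map_def fun_eq_iff orthogonal_group_linear[OF U])
    with assms show False ..
  qed
  ultimately show "\<exists>U \<in> orthogonal_group. \<exists>k. k \<noteq> 0 \<and> (\<forall>x. C' (U x) = k *s U (C x))"
    using U by blast
next
  assume "\<exists>U \<in> orthogonal_group. \<exists>k. k \<noteq> 0 \<and> (\<forall>x. C' (U x) = k *s U (C x))"
  then obtain U k where U: "U \<in> orthogonal_group" and k: "k \<noteq> 0"
    and conj: "\<And>x. C' (U x) = k *s U (C x)" by blast
  have C': "C' x = k *s U (C (inv U x))" for x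
    using conj[of "inv U x"] by (simp add: orthogonal_group_inv_simps[OF U])
  have conj_line: "conj_map U (\<lambda>x. c *s C x) = (\<lambda>x. (c / k) *s C' x)" for c
    using k by (simp add: conj_map_def fun_eq_iff C' orthogonal_group_linear[OF U])
  have line: "conj_map U ` line C = line C'"
  proof
    show "conj_map U ` line C \<subseteq> line C'" unfolding line_def using conj_line by auto
    show "line C' \<subseteq> conj_map U ` line C"
    proof
      fix D assume "D \<in> line C'"
      then obtain c where "D = (\<lambda>x. c *s C' x)" by (auto simp: line_def)
      then have "D = conj_map U (\<lambda>x. (c * k) *s C x)" using k by (simp add: conj_line)
      then show "D \<in> conj_map U ` line C" by (auto simp: line_def)
    qed
  qed
  have image: "conj_map V ` line C' = conj_map (\<lambda>x. V (U x)) ` line C"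
    if "V \<in> orthogonal_group" for V
    unfolding line[symmetric] image_image by (simp add: conj_map_comp[OF U that])
  show "orbit (line C) = orbit (line C')"
  proof
    show "orbit (line C') \<subseteq> orbit (line C)"
      unfolding orbit_def using image orthogonal_group_comp[OF _ U] by blast
    show "orbit (line C) \<subseteq> orbit (line C')"
    proof
      fix L assume "L \<in> orbit (line C)"
      then obtain V where V: "V \<in> orthogonal_group" "L = conj_map V ` line C"
        by (auto simp: orbit_def)
      have V': "(\<lambda>x. V (inv U x)) \<in> orthogonal_group"
        by (rule orthogonal_group_comp[OF V(1) orthogonal_group_inv[OF U]])
      have "L = conj_map (\<lambda>x. V (inv U x)) ` line C'"
        unfolding image[OF V'] V(2) by (simp add: orthogonal_group_inv_simps[OF U])
      with V' show "L \<in> orbit (line C')" by (auto simp: orbit_def)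
    qed
  qed
qed

lemma dext_structure_comp:
  assumes "A \<in> orthogonal_group" "\<Phi> \<in> dext_isometries"
  shows "dext_structure (\<lambda>u. A (\<Phi> u)) C (A x) (A y) = A (dext_structure \<Phi> C x y)"
  using dext_structure_apply[OF dext_isometries_orthogonal_comp[OF assms], of C "inv \<Phi> x" "inv \<Phi> y"]
  by (simp add: dext_isometry_simps(5)[OF assms(2)] dext_structure_def)

lemma automorphism_dext_structure:
  assumes A: "A \<in> orthogonal_group" and \<Phi>: "\<Phi> \<in> dext_isometries"
    and hom: "\<And>x y. A (dext_structure \<Phi> C x y) = br (A x) (A y)"
  shows "dext_structure (\<lambda>u. A (\<Phi> u)) C = br"
proof (intro ext)
  fix x y
  show "dext_structure (\<lambda>u. A (\<Phi> u)) C x y = br x y"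
    using dext_structure_comp[OF A \<Phi>, of C "inv A x" "inv A y"] hom[of "inv A x" "inv A y"]
    by (simp add: orthogonal_group_inv_simps[OF A])
qed

text \<open>
  From an i-isomorphism \<open>A\<close>, both \<open>A (\<Phi> X\<^sub>1)\<close> and \<open>\<Phi>' X\<^sub>1\<close> are central divisors of the same structure; after
  composing \<open>A\<close> with an automorphism they are proportional.
\<close>

lemma i_isomorphic_dext_structure_iff:
  fixes \<Phi> \<Phi>' :: "'n::{finite,linorder} dext_space \<Rightarrow> 'm::{finite,linorder} cvec"
  assumes \<Phi>: "\<Phi> \<in> dext_isometries" and \<Phi>': "\<Phi>' \<in> dext_isometries"
    and C: "C \<in> skew_maps - {0}" and C': "C' \<in> skew_maps - {0}"
  shows "i_isomorphic (dext_structure \<Phi> C) (dext_structure \<Phi>' C') \<longleftrightarrow>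
    orbit (line C) = orbit (line C')"
proof -
  have skew: "C \<in> skew_maps" "C' \<in> skew_maps" "C' \<noteq> 0" using C C' by auto
  show ?thesis
    unfolding orbit_line_eq_iff[OF skew(3)]
  proof
    assume "i_isomorphic (dext_structure \<Phi> C) (dext_structure \<Phi>' C')"
    then obtain A where A: "A \<in> orthogonal_group"
      and hom: "\<And>x y. A (dext_structure \<Phi> C x y) = dext_structure \<Phi>' C' (A x) (A y)"
      by (auto simp: i_isomorphic_def)
    define \<Psi> where "\<Psi> u = A (\<Phi> u)" for u
    have \<Psi>: "\<Psi> \<in> dext_isometries"
      unfolding \<Psi>_def by (rule dext_isometries_orthogonal_comp[OF A \<Phi>])
    have eq: "dext_structure \<Psi> C = dext_structure \<Phi>' C'"
      unfolding \<Psi>_def by (rule automorphism_dext_structure[OF A \<Phi> hom])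
    obtain x y where nonab: "dext_structure \<Phi>' C' x y \<noteq> 0"
      using dext_structure_nonabelian[OF \<Phi>' C'] .
    obtain T k where T: "T \<in> orthogonal_group"
        "\<And>x y. T (dext_structure \<Phi>' C' x y) = dext_structure \<Phi>' C' (T x) (T y)"
      and k: "k \<noteq> 0" "T (\<Psi> (1, 0, 0)) = k *s \<Phi>' (1, 0, 0)"
      using central_divisors_conjugate[OF dext_structure_quadratic[OF \<Phi>' skew(2)] nonab
          dext_structure_central_divisor[OF \<Psi> skew(1), unfolded eq]
          dext_structure_central_divisor[OF \<Phi>' skew(2)]] by metis
    have "dext_structure (\<lambda>u. T (\<Psi> u)) C = dext_structure \<Phi>' C'"
      by (rule automorphism_dext_structure[OF T(1) \<Psi>]) (simp add: eq T(2))
    then obtain U where "U \<in> orthogonal_group" "\<And>Y. C' (U Y) = k *s U (C Y)"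
      using dext_structure_eq_imp_conjugate[OF dext_isometries_orthogonal_comp[OF T(1) \<Psi>] \<Phi>' skew(1) _ k]
      by blast
    with k(1) show "\<exists>U \<in> orthogonal_group. \<exists>k. k \<noteq> 0 \<and> (\<forall>x. C' (U x) = k *s U (C x))"
      by blast
  next
    assume "\<exists>U \<in> orthogonal_group. \<exists>k. k \<noteq> 0 \<and> (\<forall>x. C' (U x) = k *s U (C x))"
    then obtain U k where U: "U \<in> orthogonal_group" and k: "k \<noteq> 0"
      and conj: "\<And>x. C' (U x) = k *s U (C x)" by blast
    define \<Psi> where "\<Psi> u = \<Phi>' (dext_rescale k U u)" for u
    have \<Psi>: "\<Psi> \<in> dext_isometries"
      unfolding \<Psi>_def by (rule dext_isometries_rescale[OF \<Phi>' U k])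
    have bracket: "dext_bracket C' (dext_rescale k U a) (dext_rescale k U b)
        = dext_rescale k U (dext_bracket C a b)" for a b
      using k by (cases a; cases b)
        (simp add: dext_bracket_def dext_rescale_def conj cform_simps
          orthogonal_group_isometry[OF U] orthogonal_group_linear[OF U])
    define A where "A x = \<Psi> (inv \<Phi> x)" for x
    have "A (dext_structure \<Phi> C x y) = dext_structure \<Phi>' C' (A x) (A y)" for x y
      by (simp add: A_def \<Psi>_def dext_structure_def dext_isometry_simps(4)[OF \<Phi>]
          dext_isometry_simps(4)[OF \<Phi>'] bracket)
    moreover have "A \<in> orthogonal_group"
      unfolding A_def[abs_def] by (rule dext_isometries_quotient[OF \<Phi> \<Psi>])
    ultimately show "i_isomorphic (dext_structure \<Phi> C) (dext_structure \<Phi>' C')"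
      unfolding i_isomorphic_def by blast
  qed
qed

lemma equiv_i_iso_rel: "equiv solvable_singular_structures i_iso_rel"
proof (rule equivI)
  show "i_iso_rel \<subseteq> solvable_singular_structures \<times> solvable_singular_structures"
    by (auto simp: i_iso_rel_def)
  show "refl_on solvable_singular_structures i_iso_rel"
    using orthogonal_group_id by (auto intro!: refl_onI simp: i_iso_rel_def i_isomorphic_def)
  show "sym i_iso_rel"
  proof (rule symI)
    fix br br' assume *: "(br, br') \<in> i_iso_rel"
    then obtain A where A: "A \<in> orthogonal_group" and hom: "\<And>x y. A (br x y) = br' (A x) (A y)"
      by (auto simp: i_iso_rel_def i_isomorphic_def)
    have "inv A (br' x y) = br (inv A x) (inv A y)" for x y
      using hom[of "inv A x" "inv A y"] orthogonal_group_inv_simps[OF A] by metis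
    with * orthogonal_group_inv[OF A] show "(br', br) \<in> i_iso_rel"
      by (auto simp: i_iso_rel_def i_isomorphic_def)
  qed
  show "trans i_iso_rel"
  proof (rule transI)
    fix br br' br'' assume *: "(br, br') \<in> i_iso_rel" "(br', br'') \<in> i_iso_rel"
    then obtain A A' where A: "A \<in> orthogonal_group" "\<And>x y. A (br x y) = br' (A x) (A y)"
      and A': "A' \<in> orthogonal_group" "\<And>x y. A' (br' x y) = br'' (A' x) (A' y)"
      by (auto simp: i_iso_rel_def i_isomorphic_def)
    have "i_isomorphic br br''"
      unfolding i_isomorphic_def
      by (rule bexI[OF _ orthogonal_group_comp[OF A'(1) A(1)]]) (simp add: A A')
    with * show "(br, br'') \<in> i_iso_rel" by (auto simp: i_iso_rel_def)
  qed
qed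

text \<open>
  A central divisor exists, is isotropic, and can be taken for \<open>X\<^sub>1\<close>.
\<close>

lemma solvable_singular_is_dext_structure:
  fixes br :: "'m::{finite,linorder} cvec \<Rightarrow> 'm cvec \<Rightarrow> 'm cvec"
  assumes card: "CARD('m) = CARD('n::{finite,linorder}) + 2"
    and br: "br \<in> solvable_singular_structures"
  obtains \<Phi> :: "'n::{finite,linorder} dext_space \<Rightarrow> 'm cvec" and C
  where "\<Phi> \<in> dext_isometries" "C \<in> skew_maps - {0}" "br = dext_structure \<Phi> C"
proof -
  have q: "quadratic_structure br" and sol: "solvable br"
    using br by (simp_all add: solvable_singular_structures_def)
  obtain x y a where nonab: "br x y \<noteq> 0" and a: "divides_assoc_form br a" "a \<noteq> 0"
    using br unfolding solvable_singular_structures_def singular_def dup_pos_iff by blast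
  obtain v where v: "central_divisor br v"
    using solvable_singular_central_divisor[OF q nonab sol a] by blast
  then have "cform v v = 0"
    using divisor_orthogonal_center[of br v v x y] nonab by (simp add: central_divisor_def)
  with v obtain \<Phi> :: "'n dext_space \<Rightarrow> 'm cvec" where \<Phi>: "\<Phi> \<in> dext_isometries" "\<Phi> (1, 0, 0) = v"
    using isotropic_extends_to_dext_isometry[OF card, of v] by (auto simp: central_divisor_def)
  obtain C where "C \<in> skew_maps - {0}" "br = dext_structure \<Phi> C"
    using central_divisor_dext_structure[OF q nonab \<Phi>(1)] v \<Phi>(2) by blast
  with \<Phi>(1) show ?thesis by (rule that)
qed

theorem theorem3:
  fixes n :: nat
  assumes "n \<ge> 2"
    and "CARD('n::{finite,linorder}) = n"
    and "CARD('m::{finite,linorder}) = n + 2"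
  shows "\<exists>F. bij_betw F
        (proj_orbits :: ('n cvec \<Rightarrow> 'n cvec) set set set)
        (i_iso_classes :: ('m cvec \<Rightarrow> 'm cvec \<Rightarrow> 'm cvec) set set) \<and>
      (\<forall>C \<in> skew_maps - {0}. \<forall>\<Phi> \<in> dext_isometries.
        F (orbit (line C)) = i_iso_rel `` {dext_structure \<Phi> C})"
proof -
  have card: "CARD('m) = CARD('n) + 2" using assms by simp
  obtain \<Psi> :: "'n dext_space \<Rightarrow> 'm cvec" where \<Psi>: "\<Psi> \<in> dext_isometries"
    using dext_isometries_nonempty[OF card] by blast
  have class_eq: "i_iso_rel `` {dext_structure \<Phi> C} = i_iso_rel `` {dext_structure \<Phi>' C'} \<longleftrightarrow>
      orbit (line C) = orbit (line C')"
    if "\<Phi> \<in> dext_isometries" "\<Phi>' \<in> dext_isometries" "C \<in> skew_maps - {0}" "C' \<in> skew_maps - {0}"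
    for \<Phi> \<Phi>' :: "'n dext_space \<Rightarrow> 'm cvec" and C C'
    using that dext_structure_solvable_singular
    by (subst eq_equiv_class_iff[OF equiv_i_iso_rel])
      (auto simp: i_iso_rel_def i_isomorphic_dext_structure_iff)
  \<comment> \<open>\<open>F\<close> uses a choice of representatives \<open>C\<close> and one isometry \<open>\<Psi>\<close>; by \<open>class_eq\<close> its values depend on neither.\<close>
  define rep :: "('n cvec \<Rightarrow> 'n cvec) set set \<Rightarrow> 'n cvec \<Rightarrow> 'n cvec" where
    "rep O' = (SOME C. C \<in> skew_maps - {0} \<and> orbit (line C) = O')" for O'
  have rep: "rep (orbit (line C)) \<in> skew_maps - {0}" "orbit (line (rep (orbit (line C)))) = orbit (line C)"
    if "C \<in> skew_maps - {0}" for C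
    using someI[of "\<lambda>D. D \<in> skew_maps - {0} \<and> orbit (line D) = orbit (line C)" C] that
    by (simp_all add: rep_def)
  define F where "F O' = i_iso_rel `` {dext_structure \<Psi> (rep O')}" for O'
  have F: "F (orbit (line C)) = i_iso_rel `` {dext_structure \<Phi> C}"
    if "C \<in> skew_maps - {0}" "\<Phi> \<in> dext_isometries" for C \<Phi>
    unfolding F_def using class_eq[OF \<Psi> that(2) rep(1)[OF that(1)] that(1)] rep(2)[OF that(1)] by simp
  have "bij_betw F proj_orbits i_iso_classes"
  proof (rule bij_betw_imageI)
    show "inj_on F proj_orbits"
    proof (rule inj_onI)
      fix O1 O2 :: "('n cvec \<Rightarrow> 'n cvec) set set"
      assume "O1 \<in> proj_orbits" "O2 \<in> proj_orbits" "F O1 = F O2"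
      moreover from this obtain C1 C2 where "C1 \<in> skew_maps - {0}" "O1 = orbit (line C1)"
        "C2 \<in> skew_maps - {0}" "O2 = orbit (line C2)"
        unfolding proj_orbits_def proj_skew_def by blast
      ultimately show "O1 = O2" using class_eq[OF \<Psi> \<Psi>, of C1 C2] F[OF _ \<Psi>] by metis
    qed
    show "F ` proj_orbits = i_iso_classes"
    proof
      show "F ` proj_orbits \<subseteq> i_iso_classes"
      proof
        fix K assume "K \<in> F ` proj_orbits"
        then obtain C where C: "C \<in> skew_maps - {0}" "K = F (orbit (line C))"
          unfolding proj_orbits_def proj_skew_def by blast
        then show "K \<in> i_iso_classes"
          unfolding i_iso_classes_def
          by (simp only: F[OF C(1) \<Psi>] quotientI[OF dext_structure_solvable_singular[OF \<Psi> C(1)]])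
      qed
      show "i_iso_classes \<subseteq> F ` proj_orbits"
      proof
        fix K :: "('m cvec \<Rightarrow> 'm cvec \<Rightarrow> 'm cvec) set" assume "K \<in> i_iso_classes"
        then obtain br where br: "br \<in> solvable_singular_structures" "K = i_iso_rel `` {br}"
          unfolding i_iso_classes_def by (rule quotientE)
        obtain \<Phi> :: "'n dext_space \<Rightarrow> 'm cvec" and C
          where "\<Phi> \<in> dext_isometries" "C \<in> skew_maps - {0}" "br = dext_structure \<Phi> C"
          using solvable_singular_is_dext_structure[OF card br(1)] .
        with br(2) show "K \<in> F ` proj_orbits"
          unfolding proj_orbits_def proj_skew_def using F by blast
      qed
    qed
  qed
  with F show ?thesis by blast
qed

end
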